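(* There exists a simple connected 4-regular planar graph that does not admit a realization as a system of circles.
   Context: A realization of a simple connected 4-regular planar graph $G$ as a system of circles is a finite set of circles in the plane such that, taking as vertices all points at which two of the circles cross or touch, and as edges all circular arcs of these circles between consecutive such points, the resulting plane graph is $G$. *)

theory Defs
  imports "HOL-Complex_Analysis.Contour_Integration" "Graph_Theory.Graph_Theory"
begin

text \<open>The plane is \<^typ>\<open>complex\<close>. An undirected graph is a symmetric digraph, so every
  edge is a pair of opposite arcs and the degree of a vertex is its out-degree.\<close>

definition regular_graph :: "nat \<Rightarrow> ('a, 'b) pre_digraph \<Rightarrow> bool" where
  "regular_graph k G \<longleftrightarrow> (\<forall>v \<in> verts G. out_degree G v = k)"

text \<open>A plane drawing of a simple graph: \<open>pos\<close> places the vertices and \<open>D {u, v}\<close> is the simple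
  curve that represents the edge between \<open>u\<close> and \<open>v\<close>. (Parallel edges would share one curve, so
  the definition is meant for simple graphs only.)\<close>

definition plane_drawing ::
  "('a, 'b) pre_digraph \<Rightarrow> ('a \<Rightarrow> complex) \<Rightarrow> ('a set \<Rightarrow> complex set) \<Rightarrow> bool" where
  "plane_drawing G pos D \<longleftrightarrow>
     inj_on pos (verts G) \<and>
     (\<forall>(u, v) \<in> arcs_ends G.
        (\<exists>g. Path_Connected.arc g \<and> pathstart g = pos u \<and> pathfinish g = pos v
             \<and> path_image g = D {u, v}) \<and>
        D {u, v} \<inter> pos ` verts G = {pos u, pos v}) \<and>
     (\<forall>(u, v) \<in> arcs_ends G. \<forall>(x, y) \<in> arcs_ends G.
        {u, v} \<noteq> {x, y} \<longrightarrow> D {u, v} \<inter> D {x, y} \<subseteq> pos ` verts G)"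

definition planar_graph :: "('a, 'b) pre_digraph \<Rightarrow> bool" where
  "planar_graph G \<longleftrightarrow> (\<exists>pos D. plane_drawing G pos D)"

definition circle_system :: "complex set set \<Rightarrow> bool" where
  "circle_system \<C> \<longleftrightarrow> finite \<C> \<and> (\<forall>K \<in> \<C>. \<exists>c r. 0 < r \<and> K = sphere c r)"

text \<open>Two distinct circles cross or touch at each of their common points.\<close>

definition meeting_points :: "complex set set \<Rightarrow> complex set" where
  "meeting_points \<C> = {p. \<exists>K \<in> \<C>. \<exists>L \<in> \<C>. K \<noteq> L \<and> p \<in> K \<and> p \<in> L}"

text \<open>The circular arcs between consecutive meeting points, as oriented paths. The path runs
  counterclockwise if \<open>a < b\<close> and clockwise if \<open>b < a\<close>, so every circular arc occurs exactly
  twice, once in each direction. A circle with a single meeting point contributes a loop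
  (\<open>\<bar>b - a\<bar> = 2 * pi\<close>), and a circle without meeting points contributes nothing.\<close>

definition consecutive_arcs :: "complex set set \<Rightarrow> (real \<Rightarrow> complex) set" where
  "consecutive_arcs \<C> =
     {part_circlepath c r a b | c r a b.
        0 < r \<and> sphere c r \<in> \<C> \<and> 0 < \<bar>b - a\<bar> \<and> \<bar>b - a\<bar> \<le> 2 * pi \<and>
        pathstart (part_circlepath c r a b) \<in> meeting_points \<C> \<and>
        pathfinish (part_circlepath c r a b) \<in> meeting_points \<C> \<and>
        (\<forall>t. 0 < t \<and> t < 1 \<longrightarrow> part_circlepath c r a b t \<notin> meeting_points \<C>)}"

definition circle_system_graph :: "complex set set \<Rightarrow> (complex, real \<Rightarrow> complex) pre_digraph" where
  "circle_system_graph \<C> =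
     \<lparr>verts = meeting_points \<C>, arcs = consecutive_arcs \<C>, tail = pathstart, head = pathfinish\<rparr>"

text \<open>The isomorphism is one of multigraphs: if the circles produce loops or parallel edges, they
  do not realize a simple graph.\<close>

definition realizable_by_circles :: "('a, 'b) pre_digraph \<Rightarrow> bool" where
  "realizable_by_circles G \<longleftrightarrow>
     (\<exists>\<C>. circle_system \<C> \<and> digraph_iso G (circle_system_graph \<C>))"

end

theory Submission
  imports Defs
begin

text \<open>
  In a realization of a 4-regular graph every vertex lies on exactly two circles, and each of them
  contains two of the four edges. Consider an 8-cycle \<open>c\<^sub>0, \<dots>, c\<^sub>7\<close> together with the four pairs
  \<open>{1, 6}, {2, 5}, {0, 3}, {4, 7}\<close>; each pair \<open>{i, j}\<close> is joined by a chain of two digons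
  \<open>c\<^sub>i = m = c\<^sub>j\<close>, and each digon is made simple by subdividing one of its edges by a vertex that
  carries a pendant block (an octahedron minus an edge). Parity forces a circle through the
  subdividing vertex to stay in the block or to avoid it. If the two edges of a digon at \<open>c\<^sub>i\<close> were
  on different circles, these circles would share the three points \<open>c\<^sub>i, m, c\<^sub>j\<close>. So every digon is
  a circle \<open>K\<^sub>i\<close>, the 8-cycle is a circle \<open>C\<close>, and \<open>K\<^sub>i\<close> touches \<open>C\<close> at \<open>c\<^sub>i\<close>.

  Inverting at \<open>c\<^sub>7\<close> turns \<open>C\<close> into a line and \<open>c\<^sub>0, \<dots>, c\<^sub>6\<close> into real numbers in monotone order.
  With suitable signed sizes \<open>\<beta>\<^sub>i\<close>, the sign being the side of \<open>C\<close>, two touching circles satisfy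
  \<open>\<beta>\<^sub>i \<beta>\<^sub>j = (x\<^sub>i - x\<^sub>j)\<^sup>2\<close> and two disjoint ones \<open>\<beta>\<^sub>i \<beta>\<^sub>j < (x\<^sub>i - x\<^sub>j)\<^sup>2\<close>, where every difference
  with \<open>x\<^sub>7\<close> counts as 1. Interlacing chains are therefore on opposite sides, which puts
  \<open>{1, 6}, {2, 5}\<close> on one side and \<open>{0, 3}, {4, 7}\<close> on the other. The first two give
  \<open>(x\<^sub>6 - x\<^sub>1) (x\<^sub>5 - x\<^sub>2) < (x\<^sub>2 - x\<^sub>1) (x\<^sub>6 - x\<^sub>5)\<close>, hence \<open>x\<^sub>5 - x\<^sub>2 < x\<^sub>2 - x\<^sub>1\<close>; the last two
  give \<open>x\<^sub>3 - x\<^sub>0 < x\<^sub>4 - x\<^sub>3\<close>, which is impossible.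
\<close>

subsection \<open>Circles touching a fixed circle\<close>

lemma dist_sq: "(dist z w)\<^sup>2 = (Re z - Re w)\<^sup>2 + (Im z - Im w)\<^sup>2" for z w :: complex
  by (simp add: dist_norm cmod_power2)

text \<open>For different centres the difference of the two squared distances is a nonconstant
  affine function, so common points lie on a line perpendicular to \<open>c' - c\<close>, and a line
  meets a circle at most twice.\<close>

lemma centres_eq_if_three_common:
  fixes c c' p q s :: complex
  assumes "p \<in> sphere c r" "q \<in> sphere c r" "s \<in> sphere c r"
    and "p \<in> sphere c' r'" "q \<in> sphere c' r'" "s \<in> sphere c' r'"
    and "p \<noteq> q" "p \<noteq> s" "q \<noteq> s"
  shows "c = c'"
proof -
  define f where "f z = (dist c z)\<^sup>2 - (dist c' z)\<^sup>2" for z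
  have f: "f p = r\<^sup>2 - r'\<^sup>2" "f q = r\<^sup>2 - r'\<^sup>2" "f s = r\<^sup>2 - r'\<^sup>2"
    using assms by (auto simp: f_def)
  define X Y where "X = Re c' - Re c" and "Y = Im c' - Im c"
  have d: "(dist c p)\<^sup>2 = (dist c q)\<^sup>2" "(dist c p)\<^sup>2 = (dist c s)\<^sup>2" using assms by auto
  define x1 y1 x2 y2 where "x1 = Re q - Re p" and "y1 = Im q - Im p"
    and "x2 = Re s - Re p" and "y2 = Im s - Im p"
  have e1: "X * x1 + Y * y1 = 0" using f(1,2) unfolding f_def dist_sq X_def Y_def x1_def y1_def by algebra
  have e2: "X * x2 + Y * y2 = 0" using f(1,3) unfolding f_def dist_sq X_def Y_def x2_def y2_def by algebra
  have e3: "x1\<^sup>2 + y1\<^sup>2 = 2 * (x1 * (Re c - Re p) + y1 * (Im c - Im p))"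
    using d(1) unfolding dist_sq x1_def y1_def by algebra
  have e4: "x2\<^sup>2 + y2\<^sup>2 = 2 * (x2 * (Re c - Re p) + y2 * (Im c - Im p))"
    using d(2) unfolding dist_sq x2_def y2_def by algebra
  have "X = 0 \<and> Y = 0"
  proof (rule ccontr)
    assume XY: "\<not> (X = 0 \<and> Y = 0)"
    \<comment> \<open>Up to the factor \<open>n\<close>, these are the positions of \<open>q\<close>
      and \<open>s\<close> on that line, measured from \<open>p\<close> in direction
      \<open>(Y, -X)\<close>. The circle allows only the positions 0 and \<open>k\<close>, and 0 is
      taken by \<open>p\<close>.\<close>
    define l1 l2 n where "l1 = x1 * Y - y1 * X" and "l2 = x2 * Y - y2 * X" and "n = X\<^sup>2 + Y\<^sup>2"
    have n: "n \<noteq> 0" using XY by (simp add: n_def sum_power2_eq_zero_iff)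
    have x: "n * x1 = l1 * Y" "n * y1 = - l1 * X" "n * x2 = l2 * Y" "n * y2 = - l2 * X"
      using e1 e2 unfolding n_def l1_def l2_def by algebra+
    define k where "k = 2 * (Y * (Re c - Re p) - X * (Im c - Im p))"
    have "l1 * (l1 - k) = 0" 
    proof -
      have "n * n * (x1\<^sup>2 + y1\<^sup>2) = l1\<^sup>2 * n" using x(1,2) unfolding n_def by algebra
      moreover have "n * n * (2 * (x1 * (Re c - Re p) + y1 * (Im c - Im p))) = n * l1 * k"
        using x(1,2) unfolding k_def by algebra
      ultimately have "n * (l1 * (l1 - k)) = 0" using e3 by algebra
      then show ?thesis using n by simp
    qed
    moreover have "l2 * (l2 - k) = 0" 
    proof -
      have "n * n * (x2\<^sup>2 + y2\<^sup>2) = l2\<^sup>2 * n" using x(3,4) unfolding n_def by algebra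
      moreover have "n * n * (2 * (x2 * (Re c - Re p) + y2 * (Im c - Im p))) = n * l2 * k"
        using x(3,4) unfolding k_def by algebra
      ultimately have "n * (l2 * (l2 - k)) = 0" using e4 by algebra
      then show ?thesis using n by simp
    qed
    moreover have "l1 \<noteq> 0"
      using x(1,2) n \<open>p \<noteq> q\<close> by (auto simp: x1_def y1_def complex_eq_iff)
    moreover have "l2 \<noteq> 0"
      using x(3,4) n \<open>p \<noteq> s\<close> by (auto simp: x2_def y2_def complex_eq_iff)
    ultimately have "l1 = l2" by simp
    then have "x1 = x2" "y1 = y2" using x n by (metis mult_left_cancel)+
    then show False using \<open>q \<noteq> s\<close> by (simp add: x1_def x2_def y1_def y2_def complex_eq_iff)
  qed
  then show ?thesis by (simp add: X_def Y_def complex_eq_iff)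
qed

lemma sphere_inject:
  fixes c c' :: complex
  assumes "sphere c r = sphere c' r'" "r > 0"
  shows "c = c' \<and> r = r'"
proof -
  have on: "c + of_real r \<in> sphere c r" "c - of_real r \<in> sphere c r" "c + \<i> * of_real r \<in> sphere c r"
    using assms(2) by (auto simp: dist_norm norm_mult)
  have "c + of_real r \<noteq> c - of_real r" "c + of_real r \<noteq> c + \<i> * of_real r"
    "c - of_real r \<noteq> c + \<i> * of_real r"
    using assms(2) by (auto simp: complex_eq_iff)
  then have "c = c'"
    using centres_eq_if_three_common[OF on on[unfolded assms(1)]] by blast
  then show ?thesis using on(1) on(1)[unfolded assms(1)] by auto
qed

text \<open>The reflection of \<open>p\<close> in the line of centres lies on both circles as well,
  so uniqueness of the common point puts \<open>p\<close> on that line.\<close>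

lemma tangent_circles_collinear:
  fixes c k p :: complex
  assumes "sphere c R \<inter> sphere k r = {p}" "c \<noteq> k"
  obtains t :: real where "p - c = of_real t * (k - c)"
proof -
  \<comment> \<open>\<open>u\<close> is the position of \<open>p\<close> in the coordinate with
    \<open>c\<close> at 0 and \<open>k\<close> at 1; conjugating it is the reflection.\<close>
  define u where "u = (p - c) / (k - c)"
  define p' where "p' = c + cnj u * (k - c)"
  have pu: "p = c + u * (k - c)" using assms(2) by (simp add: u_def)
  have "dist c p' = dist c p" by (simp add: pu p'_def dist_norm norm_mult)
  moreover have "dist k p' = dist k p"
  proof -
    have "k - p = (1 - u) * (k - c)" "k - p' = cnj (1 - u) * (k - c)"
      by (simp_all add: pu p'_def algebra_simps)
    then show ?thesis by (simp only: dist_norm norm_mult complex_mod_cnj)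
  qed
  ultimately have "p' \<in> sphere c R \<inter> sphere k r"
    using assms(1) by (auto simp: set_eq_iff)
  then have "p' = p" using assms(1) by auto
  then have "cnj u = u" using assms(2) by (simp add: pu p'_def)
  then obtain t where "u = of_real t" using Reals_cnj_iff Reals_cases by metis
  then show ?thesis using that[of t] pu by simp
qed

text \<open>One parameter covers all kinds of contact: external for \<open>\<kappa> > 1\<close>, the
  second circle inside for \<open>0 < \<kappa> < 1\<close>, the first circle inside for
  \<open>\<kappa> < 0\<close>.\<close>

lemma tangent_circle_param:
  fixes c k p :: complex
  assumes "sphere c R \<inter> sphere k r = {p}" "c \<noteq> k" "R > 0" "r > 0"
  obtains \<kappa> :: real where "\<kappa> \<noteq> 0" "\<kappa> \<noteq> 1" "k = c + of_real \<kappa> * (p - c)" "r = \<bar>1 - \<kappa>\<bar> * R"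
proof -
  obtain t where t: "p - c = of_real t * (k - c)"
    using tangent_circles_collinear[OF assms(1,2)] .
  have R: "norm (p - c) = R" and r: "norm (p - k) = r"
    using assms(1) by (auto simp: set_eq_iff dist_norm norm_minus_commute)
  have t0: "t \<noteq> 0" using t R assms(3) by auto
  have k: "k = c + of_real (1 / t) * (p - c)" using t t0 by simp
  have "p - k = of_real (1 - 1 / t) * (p - c)" by (subst k) (simp add: algebra_simps)
  then have r': "r = \<bar>1 - 1 / t\<bar> * R" using R r by (metis norm_mult norm_of_real)
  show ?thesis
    by (rule that[of "1 / t"]) (use t0 k r' assms(4) in auto)
qed

text \<open>By Heron's formula the product is 16 times the squared area of a triangle with sides
  \<open>R\<close>, \<open>r\<close> and \<open>dist c k\<close>; its apex is the common
  point.\<close>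

lemma spheres_meet:
  fixes c k :: complex
  assumes "c \<noteq> k" "R > 0" "r > 0"
    and "((R + r)\<^sup>2 - (dist c k)\<^sup>2) * ((dist c k)\<^sup>2 - (R - r)\<^sup>2) \<ge> 0"
  shows "sphere c R \<inter> sphere k r \<noteq> {}"
proof -
  define d where "d = dist c k"
  have d: "d > 0" using assms(1) by (simp add: d_def)
  \<comment> \<open>By the law of cosines, \<open>a\<close> is the signed distance from
    \<open>c\<close> to the foot of the altitude and \<open>h\<close> is the height.\<close>
  define a where "a = (d\<^sup>2 + R\<^sup>2 - r\<^sup>2) / (2 * d)"
  define h where "h = sqrt (R\<^sup>2 - a\<^sup>2)"
  have a: "2 * d * a = d\<^sup>2 + R\<^sup>2 - r\<^sup>2" using d by (simp add: a_def)
  have "4 * d\<^sup>2 * (R\<^sup>2 - a\<^sup>2) = ((R + r)\<^sup>2 - d\<^sup>2) * (d\<^sup>2 - (R - r)\<^sup>2)"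
    using a by algebra
  then have "4 * d\<^sup>2 * (R\<^sup>2 - a\<^sup>2) \<ge> 0" using assms(4) by (simp only: d_def)
  then have "R\<^sup>2 - a\<^sup>2 \<ge> 0" using d by (simp only: zero_le_mult_iff) auto
  then have h: "h\<^sup>2 = R\<^sup>2 - a\<^sup>2" by (simp add: h_def)
  define u where "u = (k - c) / of_real d"
  have u: "norm u = 1" using d by (simp add: u_def norm_divide) (simp add: d_def dist_norm norm_minus_commute)
  define z where "z = c + Complex a h * u"
  have norm_Complex: "norm (Complex x y) = sqrt (x\<^sup>2 + y\<^sup>2)" for x y by (simp add: cmod_def)
  have "norm (z - c) = R"
    using u h assms(2) by (simp add: z_def norm_mult norm_Complex)
  moreover have "norm (z - k) = r"
  proof -
    have "z - k = Complex (a - d) h * u"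
    proof -
      have k: "k = c + of_real d * u" using d by (simp add: u_def)
      have "Complex a h = Complex (a - d) h + of_real d" by (simp add: complex_eq_iff)
      then show ?thesis unfolding z_def by (subst k) (simp add: algebra_simps)
    qed
    moreover have "(a - d)\<^sup>2 + h\<^sup>2 = r\<^sup>2" using a h by algebra
    ultimately show ?thesis using u assms(3) by (simp add: norm_mult norm_Complex)
  qed
  ultimately have "z \<in> sphere c R \<inter> sphere k r" by (simp add: dist_norm norm_minus_commute)
  then show ?thesis by blast
qed

text \<open>The circles touching the circle with centre \<open>c\<close> and radius \<open>R\<close> at \<open>p\<close> have centre
  \<open>c + \<kappa> (p - c)\<close>; in terms of \<open>\<alpha> = 1 / \<kappa> - 1\<close>, whose sign tells the side, two of them touch iff
  \<open>\<bar>p - q\<bar>\<^sup>2 = 4 R\<^sup>2 \<alpha> \<beta>\<close>.\<close>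

definition touching_circle :: "complex \<Rightarrow> real \<Rightarrow> complex \<Rightarrow> real \<Rightarrow> complex set" where
  "touching_circle c R p \<alpha> = sphere (c + of_real (1 / (1 + \<alpha>)) * (p - c)) (\<bar>\<alpha> / (1 + \<alpha>)\<bar> * R)"

lemma touching_circle_exists:
  assumes "sphere c R \<inter> sphere k r = {p}" "c \<noteq> k" "R > 0" "r > 0"
  obtains \<alpha> where "\<alpha> \<noteq> 0" "\<alpha> \<noteq> - 1" "sphere k r = touching_circle c R p \<alpha>"
proof -
  obtain \<kappa> where \<kappa>: "\<kappa> \<noteq> 0" "\<kappa> \<noteq> 1" "k = c + of_real \<kappa> * (p - c)" "r = \<bar>1 - \<kappa>\<bar> * R"
    using tangent_circle_param[OF assms] .
  have "1 + (1 / \<kappa> - 1) = 1 / \<kappa>" by simp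
  moreover have "(1 / \<kappa> - 1) / (1 / \<kappa>) = 1 - \<kappa>" using \<kappa>(1) by (simp add: field_simps)
  ultimately have "sphere k r = touching_circle c R p (1 / \<kappa> - 1)"
    unfolding touching_circle_def by (simp add: \<kappa>)
  moreover have "1 / \<kappa> - 1 \<noteq> 0" "1 / \<kappa> - 1 \<noteq> - 1" using \<kappa> by auto
  ultimately show ?thesis using that by blast
qed

text \<open>For \<open>p \<noteq> q\<close> Heron's expression has the sign of
  \<open>4 * R\<^sup>2 * \<alpha> * \<beta> - (dist p q)\<^sup>2\<close>, which turns meeting and
  touching into algebra.\<close>

lemma touching_circles_discriminant:
  fixes p q c :: complex
  assumes p: "norm (p - c) = R" and q: "norm (q - c) = R"
    and \<alpha>: "\<alpha> \<noteq> - 1" and \<beta>: "\<beta> \<noteq> - 1"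
  defines "k \<equiv> c + of_real (1 / (1 + \<alpha>)) * (p - c)" and "l \<equiv> c + of_real (1 / (1 + \<beta>)) * (q - c)"
    and "r \<equiv> \<bar>\<alpha> / (1 + \<alpha>)\<bar> * R" and "s \<equiv> \<bar>\<beta> / (1 + \<beta>)\<bar> * R"
  shows "((r + s)\<^sup>2 - (dist k l)\<^sup>2) * ((dist k l)\<^sup>2 - (r - s)\<^sup>2) =
    (dist p q)\<^sup>2 * (4 * R\<^sup>2 * \<alpha> * \<beta> - (dist p q)\<^sup>2) / ((1 + \<alpha>)\<^sup>2 * (1 + \<beta>)\<^sup>2)"
proof -
  define x where "x = 1 / (1 + \<alpha>)"
  define y where "y = 1 / (1 + \<beta>)"
  define D where "D = (dist p q)\<^sup>2"
  have xa: "\<alpha> / (1 + \<alpha>) = 1 - x" and yb: "\<beta> / (1 + \<beta>) = 1 - y"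
    using \<alpha> \<beta> by (simp_all add: x_def y_def field_simps)
  have x: "x * (1 + \<alpha>) = 1" and y: "y * (1 + \<beta>) = 1" using \<alpha> \<beta> by (simp_all add: x_def y_def)
  \<comment> \<open>Law of cosines at \<open>c\<close>: the inner product of \<open>p - c\<close>
    and \<open>q - c\<close> is \<open>R\<^sup>2 - D / 2\<close>.\<close>
  have dd: "(dist k l)\<^sup>2 = (x - y)\<^sup>2 * R\<^sup>2 + x * y * D"
  proof -
    have "(Re p - Re c)\<^sup>2 + (Im p - Im c)\<^sup>2 = R\<^sup>2" "(Re q - Re c)\<^sup>2 + (Im q - Im c)\<^sup>2 = R\<^sup>2"
      using p q cmod_power2[of "p - c"] cmod_power2[of "q - c"] by simp_all
    then show ?thesis
      unfolding D_def dist_sq k_def l_def x_def[symmetric] y_def[symmetric] by simp algebra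
  qed
  have sq: "(\<bar>a\<bar> * R + \<bar>b\<bar> * R)\<^sup>2 * 1 = a\<^sup>2 * R\<^sup>2 + b\<^sup>2 * R\<^sup>2 + 2 * \<bar>a * b\<bar> * R\<^sup>2"
    "(\<bar>a\<bar> * R - \<bar>b\<bar> * R)\<^sup>2 * 1 = a\<^sup>2 * R\<^sup>2 + b\<^sup>2 * R\<^sup>2 - 2 * \<bar>a * b\<bar> * R\<^sup>2" for a b
    by (simp_all add: abs_mult power2_eq_square algebra_simps)
  have "((r + s)\<^sup>2 - (dist k l)\<^sup>2) * ((dist k l)\<^sup>2 - (r - s)\<^sup>2) =
    (4 * (1 - x) * (1 - y) * R\<^sup>2 - x * y * D) * (x * y * D)"
  proof -
    \<comment> \<open>Only \<open>P * P\<close> survives in the product, so the absolute value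
      disappears.\<close>
    define P where "P = \<bar>(1 - x) * (1 - y)\<bar>"
    have P: "P * P = ((1 - x) * (1 - y)) * ((1 - x) * (1 - y))" by (simp add: P_def)
    have "(r + s)\<^sup>2 = (1 - x)\<^sup>2 * R\<^sup>2 + (1 - y)\<^sup>2 * R\<^sup>2 + 2 * P * R\<^sup>2"
      "(r - s)\<^sup>2 = (1 - x)\<^sup>2 * R\<^sup>2 + (1 - y)\<^sup>2 * R\<^sup>2 - 2 * P * R\<^sup>2"
      using sq[of "1 - x" "1 - y"] by (simp_all add: r_def s_def xa yb P_def)
    then show ?thesis using P dd by algebra
  qed
  also have "\<dots> = D * (4 * R\<^sup>2 * \<alpha> * \<beta> - D) * (x\<^sup>2 * y\<^sup>2)"
    using x y by algebra
  also have "\<dots> = D * (4 * R\<^sup>2 * \<alpha> * \<beta> - D) / ((1 + \<alpha>)\<^sup>2 * (1 + \<beta>)\<^sup>2)"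
    by (simp add: x_def y_def power_divide)
  finally show ?thesis by (simp add: D_def)
qed

text \<open>Otherwise Heron's expression is nonnegative and \<open>spheres_meet\<close> applies,
  unless the circles are concentric.\<close>

lemma touching_circles_disjoint:
  assumes p: "p \<in> sphere c R" and q: "q \<in> sphere c R" and "p \<noteq> q" "R > 0"
    and \<alpha>: "\<alpha> \<noteq> 0" "\<alpha> \<noteq> - 1" and \<beta>: "\<beta> \<noteq> 0" "\<beta> \<noteq> - 1"
    and disj: "touching_circle c R p \<alpha> \<inter> touching_circle c R q \<beta> = {}"
  shows "4 * R\<^sup>2 * \<alpha> * \<beta> < (dist p q)\<^sup>2"
proof (rule ccontr)
  assume neg: "\<not> ?thesis"
  define k l where "k = c + of_real (1 / (1 + \<alpha>)) * (p - c)" and "l = c + of_real (1 / (1 + \<beta>)) * (q - c)"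
  define r s where "r = \<bar>\<alpha> / (1 + \<alpha>)\<bar> * R" and "s = \<bar>\<beta> / (1 + \<beta>)\<bar> * R"
  have pq: "norm (p - c) = R" "norm (q - c) = R"
    using p q by (simp_all add: dist_norm norm_minus_commute)
  have D: "(dist p q)\<^sup>2 > 0" using \<open>p \<noteq> q\<close> by simp
  note disc = touching_circles_discriminant[OF pq \<alpha>(2) \<beta>(2), folded k_def l_def r_def s_def]
  have ge: "((r + s)\<^sup>2 - (dist k l)\<^sup>2) * ((dist k l)\<^sup>2 - (r - s)\<^sup>2) \<ge> 0"
    unfolding disc using neg D by auto
  have rs: "r > 0" "s > 0" using \<alpha> \<beta> \<open>R > 0\<close> by (simp_all add: r_def s_def)
  show False
  proof (cases "k = l")
    case False
    then show ?thesis
      using spheres_meet[OF False rs ge] disj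
      by (simp add: touching_circle_def k_def l_def r_def s_def)
  next
    case True
    then have "dist k l = 0" by simp
    \<comment> \<open>For concentric circles Heron's expression is minus this square, so the radii
      agree and the circles coincide.\<close>
    have "(r + s)\<^sup>2 * (r - s)\<^sup>2 = 0"
      using ge \<open>dist k l = 0\<close> by (simp add: mult_le_0_iff zero_le_mult_iff) blast
    then have "r = s" using rs by simp
    then have "k + of_real r \<in> sphere k r \<inter> sphere l s"
      using True rs by (simp add: dist_norm)
    then show ?thesis using disj unfolding touching_circle_def k_def l_def r_def s_def by blast
  qed
qed

text \<open>The distance of the centres is the sum or the difference of the radii, so a factor of
  Heron's expression vanishes.\<close>

lemma touching_circles_tangent:
  assumes p: "p \<in> sphere c R" and q: "q \<in> sphere c R" and "p \<noteq> q" "R > 0"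
    and \<alpha>: "\<alpha> \<noteq> 0" "\<alpha> \<noteq> - 1" and \<beta>: "\<beta> \<noteq> 0" "\<beta> \<noteq> - 1"
    and tang: "touching_circle c R p \<alpha> \<inter> touching_circle c R q \<beta> = {m}"
  shows "4 * R\<^sup>2 * \<alpha> * \<beta> = (dist p q)\<^sup>2"
proof -
  define k l where "k = c + of_real (1 / (1 + \<alpha>)) * (p - c)" and "l = c + of_real (1 / (1 + \<beta>)) * (q - c)"
  define r s where "r = \<bar>\<alpha> / (1 + \<alpha>)\<bar> * R" and "s = \<bar>\<beta> / (1 + \<beta>)\<bar> * R"
  have pq: "norm (p - c) = R" "norm (q - c) = R"
    using p q by (simp_all add: dist_norm norm_minus_commute)
  note disc = touching_circles_discriminant[OF pq \<alpha>(2) \<beta>(2), folded k_def l_def r_def s_def]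
  have rs: "r > 0" "s > 0" using \<alpha> \<beta> \<open>R > 0\<close> by (simp_all add: r_def s_def)
  have tang': "sphere k r \<inter> sphere l s = {m}"
    using tang by (simp add: touching_circle_def k_def l_def r_def s_def)
  have "k \<noteq> l"
  proof
    assume "k = l"
    moreover from tang' have "m \<in> sphere k r" "m \<in> sphere l s" by auto
    ultimately have "r = s" by auto
    then have eq: "sphere k r = {m}" using tang' \<open>k = l\<close> by simp
    have "k + of_real r \<in> sphere k r" "k - of_real r \<in> sphere k r" using rs by (auto simp: dist_norm)
    then have "k + of_real r = m" "k - of_real r = m" using eq by blast+
    then show False using rs by (auto simp: complex_eq_iff)
  qed
  then obtain \<kappa> where \<kappa>: "l = k + of_real \<kappa> * (m - k)" "s = \<bar>1 - \<kappa>\<bar> * r"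
    using tangent_circle_param[OF tang' _ rs] by metis
  have "norm (m - k) = r" using tang' by (auto simp: set_eq_iff dist_norm norm_minus_commute)
  then have d: "dist k l = \<bar>\<kappa>\<bar> * r" by (simp add: \<kappa>(1) dist_norm norm_mult)
  have "((r + s)\<^sup>2 - (dist k l)\<^sup>2) * ((dist k l)\<^sup>2 - (r - s)\<^sup>2) = 0"
    by (cases "1 - \<kappa> \<ge> 0") (auto simp: d \<kappa>(2) power_mult_distrib algebra_simps power2_eq_square)
  then have "(dist p q)\<^sup>2 * (4 * R\<^sup>2 * \<alpha> * \<beta> - (dist p q)\<^sup>2) = 0"
    unfolding disc using \<alpha>(2) \<beta>(2) by (simp add: add_eq_0_iff)
  then show ?thesis using \<open>p \<noteq> q\<close> by simp
qed

subsection \<open>Chains of circles\<close>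

text \<open>For chains \<open>u, v\<close> and \<open>y, z\<close> the two separation inequalities
  are multiplied and the contact equations inserted. A common side at one end,
  \<open>u * y > 0\<close>, forces one at the other, so the multiplication is legitimate.\<close>

lemma mult_less_of_product_less:
  fixes u v y z X Y S T :: real
  assumes "u * v = X\<^sup>2" "y * z = Y\<^sup>2" "u * y < S\<^sup>2" "v * z < T\<^sup>2" "u * y > 0"
    and "0 < X" "0 < Y" "0 < S" "0 < T"
  shows "X * Y < S * T"
proof -
  have "(u * y) * (v * z) = X\<^sup>2 * Y\<^sup>2" using assms(1,2) by algebra
  then have vz: "v * z > 0" using assms(5-7) by (metis mult_pos_pos zero_less_mult_pos zero_less_power)
  have "(X * Y)\<^sup>2 = (u * y) * (v * z)" using assms(1,2) by algebra
  also have "\<dots> < S\<^sup>2 * T\<^sup>2" using assms(3-5) vz by (intro mult_strict_mono) auto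
  finally have "(X * Y)\<^sup>2 < (S * T)\<^sup>2" by (simp add: power_mult_distrib)
  then show ?thesis using assms by (simp add: power2_less_imp_less)
qed

text \<open>By \<open>adj\<close> no value separates two consecutive ones, so the sequence never
  turns back: the value after next lies beyond \<open>x j\<close>, hence beyond
  \<open>x (Suc j)\<close>.\<close>

lemma consecutive_reals_monotone:
  fixes x :: "nat \<Rightarrow> real"
  assumes distinct: "\<And>i j. i < 7 \<Longrightarrow> j < 7 \<Longrightarrow> i \<noteq> j \<Longrightarrow> x i \<noteq> x j"
    and adj: "\<And>i j. j < 6 \<Longrightarrow> i < 7 \<Longrightarrow> i \<noteq> j \<Longrightarrow> i \<noteq> Suc j \<Longrightarrow> x j < x i \<longleftrightarrow> x (Suc j) < x i"
    and "x 0 < x 1"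
  shows "j < 6 \<Longrightarrow> x j < x (Suc j)"
proof (induction j)
  case 0
  then show ?case using assms(3) by simp
next
  case (Suc j)
  have "\<not> x (Suc (Suc j)) < x j" using adj[of "Suc j" j] Suc by auto
  then have "x j < x (Suc (Suc j))" using distinct[of j "Suc (Suc j)"] Suc.prems by force
  then show ?case using adj[of j "Suc (Suc j)"] Suc.prems by auto
qed

lemma no_real_chain_configuration:
  fixes x \<beta> :: "nat \<Rightarrow> real"
  assumes mono: "\<And>j. j < 6 \<Longrightarrow> x j < x (Suc j)"
    and touch: "\<beta> 1 * \<beta> 6 = (x 1 - x 6)\<^sup>2" "\<beta> 2 * \<beta> 5 = (x 2 - x 5)\<^sup>2" "\<beta> 0 * \<beta> 3 = (x 0 - x 3)\<^sup>2"
      "\<beta> 4 * \<beta> 7 = 1"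
    and apart: "\<beta> 1 * \<beta> 0 < (x 1 - x 0)\<^sup>2" "\<beta> 6 * \<beta> 3 < (x 6 - x 3)\<^sup>2" "\<beta> 2 * \<beta> 0 < (x 2 - x 0)\<^sup>2"
      "\<beta> 5 * \<beta> 3 < (x 5 - x 3)\<^sup>2" "\<beta> 1 * \<beta> 7 < 1" "\<beta> 6 * \<beta> 4 < (x 6 - x 4)\<^sup>2"
      "\<beta> 1 * \<beta> 2 < (x 1 - x 2)\<^sup>2" "\<beta> 6 * \<beta> 5 < (x 6 - x 5)\<^sup>2" "\<beta> 0 * \<beta> 7 < 1" "\<beta> 3 * \<beta> 4 < (x 3 - x 4)\<^sup>2"
  shows False
proof -
  have o: "x 0 < x 1" "x 1 < x 2" "x 2 < x 3" "x 3 < x 4" "x 4 < x 5" "x 5 < x 6"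
    using mono[of 0] mono[of 1] mono[of 2] mono[of 3] mono[of 4] mono[of 5]
    by (simp_all add: numeral_eq_Suc)
  \<comment> \<open>On a common side \<open>mult_less_of_product_less\<close> applies, but for
    interlacing chains each gap on its right lies inside a span on its left.\<close>
  have "\<not> \<beta> 1 * \<beta> 0 > 0"
  proof
    assume "\<beta> 1 * \<beta> 0 > 0"
    then have "(x 6 - x 1) * (x 3 - x 0) < (x 1 - x 0) * (x 6 - x 3)"
      using mult_less_of_product_less[of "\<beta> 1" "\<beta> 6" "x 6 - x 1" "\<beta> 0" "\<beta> 3" "x 3 - x 0" "x 1 - x 0" "x 6 - x 3"]
        touch apart o power2_commute[of "x 1" "x 6"] power2_commute[of "x 0" "x 3"] by auto
    moreover have "(x 1 - x 0) * (x 6 - x 3) \<le> (x 3 - x 0) * (x 6 - x 1)"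
      using o by (intro mult_mono) auto
    ultimately show False by (simp add: mult.commute)
  qed
  moreover have "\<not> \<beta> 2 * \<beta> 0 > 0"
  proof
    assume "\<beta> 2 * \<beta> 0 > 0"
    then have "(x 5 - x 2) * (x 3 - x 0) < (x 2 - x 0) * (x 5 - x 3)"
      using mult_less_of_product_less[of "\<beta> 2" "\<beta> 5" "x 5 - x 2" "\<beta> 0" "\<beta> 3" "x 3 - x 0" "x 2 - x 0" "x 5 - x 3"]
        touch apart o power2_commute[of "x 2" "x 5"] power2_commute[of "x 0" "x 3"] by auto
    moreover have "(x 2 - x 0) * (x 5 - x 3) \<le> (x 3 - x 0) * (x 5 - x 2)"
      using o by (intro mult_mono) auto
    ultimately show False by (simp add: mult.commute)
  qed
  \<comment> \<open>Point 7 is at infinity: spans and gaps ending there count as 1.\<close>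
  moreover have "\<not> \<beta> 1 * \<beta> 7 > 0"
  proof
    assume "\<beta> 1 * \<beta> 7 > 0"
    then have "(x 6 - x 1) * 1 < 1 * (x 6 - x 4)"
      using mult_less_of_product_less[of "\<beta> 1" "\<beta> 6" "x 6 - x 1" "\<beta> 7" "\<beta> 4" 1 1 "x 6 - x 4"]
        touch apart o power2_commute[of "x 1" "x 6"] by (auto simp: mult.commute)
    then show False using o by simp
  qed
  moreover have "\<beta> i \<noteq> 0" if "i < 8" for i
  proof -
    have "i = 0 \<or> i = 1 \<or> i = 2 \<or> i = 3 \<or> i = 4 \<or> i = 5 \<or> i = 6 \<or> i = 7" using that by linarith
    then show ?thesis using touch o by auto
  qed
  then have "\<beta> 0 \<noteq> 0" "\<beta> 1 \<noteq> 0" "\<beta> 2 \<noteq> 0" "\<beta> 7 \<noteq> 0" by auto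
  \<comment> \<open>The sign of \<open>\<beta> 0\<close> is opposite to those of
    \<open>\<beta> 1\<close> and \<open>\<beta> 2\<close>, and that of \<open>\<beta> 1\<close> to
    those of \<open>\<beta> 0\<close> and \<open>\<beta> 7\<close>.\<close>
  ultimately have s: "\<beta> 1 * \<beta> 2 > 0" "\<beta> 0 * \<beta> 7 > 0"
    by (metis zero_less_mult_iff linorder_less_linear)+
  have in_chains: "(x 6 - x 1) * (x 5 - x 2) < (x 2 - x 1) * (x 6 - x 5)"
    using mult_less_of_product_less[of "\<beta> 1" "\<beta> 6" "x 6 - x 1" "\<beta> 2" "\<beta> 5" "x 5 - x 2" "x 2 - x 1" "x 6 - x 5"]
      touch apart o s power2_commute[of "x 1" "x 6"] power2_commute[of "x 2" "x 5"] power2_commute[of "x 1" "x 2"] by auto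
  have out_chains: "(x 3 - x 0) * 1 < 1 * (x 4 - x 3)"
    using mult_less_of_product_less[of "\<beta> 0" "\<beta> 3" "x 3 - x 0" "\<beta> 7" "\<beta> 4" 1 1 "x 4 - x 3"]
      touch apart o s power2_commute[of "x 0" "x 3"] power2_commute[of "x 3" "x 4"] by (auto simp: mult.commute)
  \<comment> \<open>By \<open>out_chains\<close>,
    \<open>x 2 - x 1 \<le> x 3 - x 0 < x 4 - x 3 \<le> x 5 - x 2\<close>.\<close>
  have "(x 2 - x 1) * (x 6 - x 5) \<le> (x 5 - x 2) * (x 6 - x 1)"
    using o out_chains by (intro mult_mono) auto
  with in_chains show False by (simp add: mult.commute)
qed

section \<open>Inversion at a point of the circle\<close>

lemma inversion_maps_circle_to_line:
  fixes c a z :: complex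
  assumes "dist c z = R" "dist c a = R" "z \<noteq> a"
  shows "Re ((a - c) / (z - a)) = - (1 / 2)"
proof -
  define u v where "u = a - c" and "v = z - a"
  have "norm (u + v) = norm u" using assms by (simp add: u_def v_def dist_norm norm_minus_commute)
  then have "(norm (u + v))\<^sup>2 = (norm u)\<^sup>2" by simp
  \<comment> \<open>\<open>Re (u / v)\<close> is the inner product of \<open>u\<close> and
    \<open>v\<close> divided by the squared norm of \<open>v\<close>.\<close>
  then have "2 * (Re u * Re v + Im u * Im v) = - ((Re v)\<^sup>2 + (Im v)\<^sup>2)"
    unfolding cmod_power2 by (simp add: power2_eq_square algebra_simps)
  moreover have "(Re v)\<^sup>2 + (Im v)\<^sup>2 \<noteq> 0" using assms(3) by (simp add: v_def complex_eq_iff sum_power2_eq_zero_iff)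
  ultimately show ?thesis by (simp add: Re_divide u_def[symmetric] v_def[symmetric] field_simps)
qed

text \<open>The images differ by \<open>(a - c) * (w - z) / ((z - a) * (w - a))\<close>, which is
  purely imaginary because their real parts agree; the factors besides \<open>z - w\<close> belong
  to single points.\<close>

lemma dist_under_inversion:
  fixes c a z w :: complex
  defines "x \<equiv> \<lambda>z. Im ((a - c) / (z - a))"
  assumes z: "dist c z = R" "z \<noteq> a" and w: "dist c w = R" "w \<noteq> a" and a: "dist c a = R" and "R > 0"
  shows "R\<^sup>2 * (dist z w)\<^sup>2 = (dist z a)\<^sup>2 * (dist w a)\<^sup>2 * (x z - x w)\<^sup>2"
proof -
  have "(a - c) / (z - a) - (a - c) / (w - a) = \<i> * of_real (x z - x w)"
    using inversion_maps_circle_to_line[OF z(1) a z(2)] inversion_maps_circle_to_line[OF w(1) a w(2)]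
    by (simp add: complex_eq_iff x_def)
  moreover have "(a - c) / (z - a) - (a - c) / (w - a) = (a - c) * (w - z) / ((z - a) * (w - a))"
    using z(2) w(2) by (simp add: field_simps)
  ultimately have "norm ((a - c) * (w - z) / ((z - a) * (w - a))) = norm (\<i> * of_real (x z - x w))"
    by (simp only:)
  then have "norm (a - c) * norm (w - z) / (norm (z - a) * norm (w - a)) = \<bar>x z - x w\<bar>"
    by (simp only: norm_mult norm_divide norm_ii norm_of_real mult_1)
  moreover have "norm (a - c) = R" using a by (simp add: dist_norm norm_minus_commute)
  ultimately have "R * dist z w = \<bar>x z - x w\<bar> * (dist z a * dist w a)"
    using z(2) w(2) by (simp add: divide_eq_eq dist_norm norm_minus_commute)
  then have "(R * dist z w)\<^sup>2 = (\<bar>x z - x w\<bar> * (dist z a * dist w a))\<^sup>2" by simp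
  then show ?thesis by (simp add: power_mult_distrib algebra_simps)
qed

text \<open>The hypothesis \<open>path\<close> encodes the cyclic order: consecutive points are
  joined inside the circle without passing any of the eight points on the way.\<close>

lemma no_circle_chain_configuration:
  fixes p :: "nat \<Rightarrow> complex" and K :: "nat \<Rightarrow> complex set"
  assumes "R > 0"
    and on: "\<And>i. i < 8 \<Longrightarrow> p i \<in> sphere c R"
    and inj: "inj_on p {..<8}"
    and circle: "\<And>i. i < 8 \<Longrightarrow> \<exists>k r. 0 < r \<and> K i = sphere k r"
    and touch: "\<And>i. i < 8 \<Longrightarrow> sphere c R \<inter> K i = {p i}"
    and chain: "\<And>i j. (i, j) \<in> {(1, 6), (2, 5), (0, 3), (4, 7)} \<Longrightarrow> \<exists>m. K i \<inter> K j = {m}"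
    and apart: "\<And>i j. i < 8 \<Longrightarrow> j < 8 \<Longrightarrow> i \<noteq> j \<Longrightarrow>
      (i, j) \<notin> {(1, 6), (2, 5), (0, 3), (4, 7), (6, 1), (5, 2), (3, 0), (7, 4)} \<Longrightarrow> K i \<inter> K j = {}"
    and path: "\<And>j. j < 6 \<Longrightarrow> \<exists>g. path g \<and> pathstart g = p j \<and> pathfinish g = p (Suc j) \<and>
      path_image g \<subseteq> sphere c R \<and> (\<forall>t. 0 < t \<and> t < 1 \<longrightarrow> g t \<notin> p ` {..<8})"
  shows False
proof -
  have "\<exists>\<alpha>. \<alpha> \<noteq> 0 \<and> \<alpha> \<noteq> - 1 \<and> K i = touching_circle c R (p i) \<alpha>" if i: "i < 8" for i
  proof -
    obtain k r where kr: "0 < r" "K i = sphere k r" using circle[OF i] by blast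
    have single: "sphere c R \<inter> sphere k r = {p i}" using touch[OF i] kr by simp
    have "c \<noteq> k"
    proof
      assume "c = k"
      moreover have "p i \<in> sphere c R" "p i \<in> sphere k r" using single by auto
      ultimately have "sphere c R = {p i}" using single by auto
      moreover have "c + of_real R \<in> sphere c R" "c - of_real R \<in> sphere c R"
        using \<open>R > 0\<close> by (auto simp: dist_norm)
      ultimately have "c + of_real R = c - of_real R" by auto
      then show False using \<open>R > 0\<close> by (simp add: complex_eq_iff)
    qed
    then show ?thesis using touching_circle_exists[OF single _ \<open>R > 0\<close> kr(1)] kr(2) by metis
  qed
  then obtain \<alpha> where \<alpha>: "\<And>i. i < 8 \<Longrightarrow> \<alpha> i \<noteq> 0" "\<And>i. i < 8 \<Longrightarrow> \<alpha> i \<noteq> - 1"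
    "\<And>i. i < 8 \<Longrightarrow> K i = touching_circle c R (p i) (\<alpha> i)"
    by metis
  have ne: "p i \<noteq> p j" if "i < 8" "j < 8" "i \<noteq> j" for i j
    using inj that by (auto simp: inj_on_def)
  have eq: "4 * R\<^sup>2 * \<alpha> i * \<alpha> j = (dist (p i) (p j))\<^sup>2"
    if ij: "(i, j) \<in> {(1, 6), (2, 5), (0, 3), (4, 7)}" for i j
  proof -
    have i: "i < 8" "j < 8" "i \<noteq> j" using ij by auto
    obtain m where "K i \<inter> K j = {m}" using chain[OF ij] by blast
    then show ?thesis
      using touching_circles_tangent[OF on on ne \<open>R > 0\<close> \<alpha>(1,2,1,2)] i \<alpha>(3) by metis
  qed
  have less: "4 * R\<^sup>2 * \<alpha> i * \<alpha> j < (dist (p i) (p j))\<^sup>2"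
    if i: "i < 8" "j < 8" "i \<noteq> j"
      "(i, j) \<notin> {(1, 6), (2, 5), (0, 3), (4, 7), (6, 1), (5, 2), (3, 0), (7, 4)}" for i j
    using touching_circles_disjoint[OF on on ne \<open>R > 0\<close> \<alpha>(1,2,1,2)] i apart[OF i] \<alpha>(3) by metis
  define f where "f z = Im ((p 7 - c) / (z - p 7))" for z
  define x where "x i = f (p i)" for i
  \<comment> \<open>The point factors of \<open>dist_under_inversion\<close> are absorbed into the
    sizes; the value at 7 makes products with it compare with 1.\<close>
  define \<beta> where "\<beta> i = (if i = 7 then 2 * \<alpha> 7 else 2 * R\<^sup>2 * \<alpha> i / (dist (p i) (p 7))\<^sup>2)" for i
  have c7: "dist c (p i) = R" if "i < 8" for i using on[OF that] by simp
  have p7: "p i \<noteq> p 7" if "i < 7" for i using ne[of i 7] that by auto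
  have R2: "R\<^sup>2 > 0" using \<open>R > 0\<close> by simp
  have scale: "4 * R\<^sup>2 * \<alpha> i * \<alpha> j = (dist (p i) (p j))\<^sup>2 \<longleftrightarrow> \<beta> i * \<beta> j = (x i - x j)\<^sup>2"
    "4 * R\<^sup>2 * \<alpha> i * \<alpha> j < (dist (p i) (p j))\<^sup>2 \<longleftrightarrow> \<beta> i * \<beta> j < (x i - x j)\<^sup>2"
    if "i < 7" "j < 7" for i j
  proof -
    define D where "D = (dist (p i) (p 7))\<^sup>2 * (dist (p j) (p 7))\<^sup>2"
    have D: "D > 0" using p7 that by (simp add: D_def)
    have d: "R\<^sup>2 * (dist (p i) (p j))\<^sup>2 = D * (x i - x j)\<^sup>2"
      using dist_under_inversion[of c "p i" R "p 7" "p j"] c7 p7 that \<open>R > 0\<close>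
      by (simp add: x_def f_def D_def)
    have b: "R\<^sup>2 * (4 * R\<^sup>2 * \<alpha> i * \<alpha> j) = D * (\<beta> i * \<beta> j)"
      using that p7 by (simp add: \<beta>_def D_def power2_eq_square)
    show "4 * R\<^sup>2 * \<alpha> i * \<alpha> j = (dist (p i) (p j))\<^sup>2 \<longleftrightarrow> \<beta> i * \<beta> j = (x i - x j)\<^sup>2"
      using d b D R2 by (metis mult_left_cancel less_numeral_extra(3))
    show "4 * R\<^sup>2 * \<alpha> i * \<alpha> j < (dist (p i) (p j))\<^sup>2 \<longleftrightarrow> \<beta> i * \<beta> j < (x i - x j)\<^sup>2"
      using d b D R2 by (metis mult_less_cancel_left_pos)
  qed
  have scale7: "4 * R\<^sup>2 * \<alpha> i * \<alpha> 7 = (dist (p i) (p 7))\<^sup>2 \<longleftrightarrow> \<beta> i * \<beta> 7 = 1"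
    "4 * R\<^sup>2 * \<alpha> i * \<alpha> 7 < (dist (p i) (p 7))\<^sup>2 \<longleftrightarrow> \<beta> i * \<beta> 7 < 1"
    if "i < 7" for i
  proof -
    have D: "(dist (p i) (p 7))\<^sup>2 > 0" using p7 that by simp
    have b: "4 * R\<^sup>2 * \<alpha> i * \<alpha> 7 = (dist (p i) (p 7))\<^sup>2 * (\<beta> i * \<beta> 7)"
      using that p7 by (simp add: \<beta>_def)
    show "4 * R\<^sup>2 * \<alpha> i * \<alpha> 7 = (dist (p i) (p 7))\<^sup>2 \<longleftrightarrow> \<beta> i * \<beta> 7 = 1"
      unfolding b using D by simp
    show "4 * R\<^sup>2 * \<alpha> i * \<alpha> 7 < (dist (p i) (p 7))\<^sup>2 \<longleftrightarrow> \<beta> i * \<beta> 7 < 1"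
      unfolding b using D mult_less_cancel_left_pos[OF D, of "\<beta> i * \<beta> 7" 1] by simp
  qed
  have f_inj: "z = w" if z: "z \<in> sphere c R" "z \<noteq> p 7" and w: "w \<in> sphere c R" "w \<noteq> p 7" and "f z = f w" for z w
  proof -
    have "R\<^sup>2 * (dist z w)\<^sup>2 = 0"
      using dist_under_inversion[of c z R "p 7" w] that c7[of 7] \<open>R > 0\<close> by (simp add: f_def)
    then show ?thesis using R2 by simp
  qed
  have x_distinct: "x i \<noteq> x j" if "i < 7" "j < 7" "i \<noteq> j" for i j
    using f_inj[of "p i" "p j"] on p7 ne[of i j] that by (auto simp: x_def)
  \<comment> \<open>The arc from \<open>p j\<close> to \<open>p (Suc j)\<close> avoids
    \<open>p 7\<close>, so its image under \<open>f\<close> is connected; it contains the images of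
    both ends but, as \<open>f\<close> is injective, not \<open>x i\<close>.\<close>
  have x_adj: "x j < x i \<longleftrightarrow> x (Suc j) < x i" if j: "j < 6" and i: "i < 7" "i \<noteq> j" "i \<noteq> Suc j" for i j
  proof -
    obtain g where g: "path g" "pathstart g = p j" "pathfinish g = p (Suc j)" "path_image g \<subseteq> sphere c R"
      "\<And>t. 0 < t \<Longrightarrow> t < 1 \<Longrightarrow> g t \<notin> p ` {..<8}"
      using path[OF j] by blast
    have avoid: "g t \<noteq> p k" if "0 \<le> t" "t \<le> 1" "k < 8" "k \<noteq> j" "k \<noteq> Suc j" for t k
    proof -
      consider "t = 0" | "t = 1" | "0 < t" "t < 1" using \<open>0 \<le> t\<close> \<open>t \<le> 1\<close> by linarith
      then show ?thesis
      proof cases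
        case 1
        then show ?thesis using g(2) ne[of j k] that j by (auto simp: pathstart_def)
      next
        case 2
        then show ?thesis using g(3) ne[of "Suc j" k] that j by (auto simp: pathfinish_def)
      next
        case 3
        then show ?thesis using g(5)[of t] that by auto
      qed
    qed
    have "continuous_on {0..1} (\<lambda>t. f (g t))"
      unfolding f_def using g(1) avoid[of _ 7] j
      by (intro continuous_intros) (auto simp: path_def)
    then have conn: "Topological_Spaces.connected ((\<lambda>t. f (g t)) ` {0..1})"
      by (intro connected_continuous_image) auto
    have ends: "x j \<in> (\<lambda>t. f (g t)) ` {0..1}" "x (Suc j) \<in> (\<lambda>t. f (g t)) ` {0..1}"
      using g(2,3) by (auto simp: x_def pathstart_def pathfinish_def image_iff intro: bexI[of _ 0] bexI[of _ 1])
    have "x i \<notin> (\<lambda>t. f (g t)) ` {0..1}"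
    proof
      assume "x i \<in> (\<lambda>t. f (g t)) ` {0..1}"
      then obtain t where t: "0 \<le> t" "t \<le> 1" "f (p i) = f (g t)" by (auto simp: x_def)
      have "g t \<in> path_image g" using t by (simp add: path_image_def)
      then have gt: "g t \<in> sphere c R" using g(4) by blast
      have "g t \<noteq> p 7" using avoid[of t 7] t j by simp
      moreover have "p i \<in> sphere c R" "p i \<noteq> p 7" using on[of i] p7[of i] i(1) by simp_all
      ultimately have "p i = g t" using f_inj gt t(3) by blast
      then show False using avoid[of t i] t i by simp
    qed
    then have "\<not> (x j \<le> x i \<and> x i \<le> x (Suc j))" "\<not> (x (Suc j) \<le> x i \<and> x i \<le> x j)"
      using connectedD_interval[OF conn ends] connectedD_interval[OF conn ends(2,1)] by blast+
    then show ?thesis by linarith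
  qed
  note eqs = scale(1)[THEN iffD1, OF _ _ eq] and lesss = scale(2)[THEN iffD1, OF _ _ less]
  have T: "\<beta> 1 * \<beta> 6 = (x 1 - x 6)\<^sup>2" "\<beta> 2 * \<beta> 5 = (x 2 - x 5)\<^sup>2" "\<beta> 0 * \<beta> 3 = (x 0 - x 3)\<^sup>2"
    "\<beta> 4 * \<beta> 7 = 1"
    by (rule eqs scale7(1)[THEN iffD1, OF _ eq]; simp)+
  have A: "\<beta> 1 * \<beta> 0 < (x 1 - x 0)\<^sup>2" "\<beta> 6 * \<beta> 3 < (x 6 - x 3)\<^sup>2" "\<beta> 2 * \<beta> 0 < (x 2 - x 0)\<^sup>2"
    "\<beta> 5 * \<beta> 3 < (x 5 - x 3)\<^sup>2" "\<beta> 1 * \<beta> 7 < 1" "\<beta> 6 * \<beta> 4 < (x 6 - x 4)\<^sup>2"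
    "\<beta> 1 * \<beta> 2 < (x 1 - x 2)\<^sup>2" "\<beta> 6 * \<beta> 5 < (x 6 - x 5)\<^sup>2" "\<beta> 0 * \<beta> 7 < 1" "\<beta> 3 * \<beta> 4 < (x 3 - x 4)\<^sup>2"
    by (rule lesss scale7(2)[THEN iffD1, OF _ less]; simp)+
  show False
  proof (cases "x 0 < x 1")
    case True
    then show ?thesis
      using no_real_chain_configuration[of x \<beta>, OF _ T A]
        consecutive_reals_monotone[of x, OF x_distinct x_adj] by blast
  next
    case False
    \<comment> \<open>If the points run in the decreasing direction, negation restores the order and
      keeps the squares.\<close>
    then have "- x 0 < - x 1" using x_distinct[of 0 1] by auto
    moreover have "- x j < - x i \<longleftrightarrow> - x (Suc j) < - x i"
      if "j < 6" "i < 7" "i \<noteq> j" "i \<noteq> Suc j" for i j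
      using x_adj[OF that] x_distinct[of i j] x_distinct[of i "Suc j"] that by auto
    ultimately have "- x j < - x (Suc j)" if "j < 6" for j
      using consecutive_reals_monotone[of "\<lambda>i. - x i"] x_distinct that by simp
    moreover have "(- x i - - x j)\<^sup>2 = (x i - x j)\<^sup>2" for i j by (simp add: power2_commute)
    ultimately show ?thesis
      using no_real_chain_configuration[of "\<lambda>i. - x i" \<beta>] T A by simp
  qed
qed

subsection \<open>Arcs of a circle system\<close>

lemma part_circlepath_cis:
  "part_circlepath c r a b t = c + of_real r * cis (a + t * (b - a))"
  by (simp add: part_circlepath_def cis_conv_exp linepath_def algebra_simps)

lemma cis_eq_iff_int: "cis x = cis y \<longleftrightarrow> (\<exists>n::int. x = y + 2 * pi * of_int n)"
  using sin_cos_eq_iff[of x y] by (auto simp: complex_eq_iff)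

lemma sphere_cis:
  fixes c :: complex
  assumes "p \<in> sphere c r" "0 < r"
  obtains \<theta> where "p = c + of_real r * cis \<theta>"
proof
  have "norm (p - c) = r" using assms by (simp add: dist_norm norm_minus_commute)
  then show "p = c + of_real r * cis (Arg (p - c))"
    using rcis_cmod_Arg[of "p - c"] by (simp add: rcis_def)
qed

lemma cis_on_sphere [simp]: "0 \<le> r \<Longrightarrow> c + of_real r * cis \<theta> \<in> sphere c r"
  by (simp add: dist_norm norm_mult)

text \<open>Finiteness of the meeting points provides a next one along each circle.\<close>

locale circle_arrangement =
  fixes \<C> :: "complex set set"
  assumes circle_system: "circle_system \<C>"
    and finite_meeting: "finite (meeting_points \<C>)"
begin

abbreviation "M \<equiv> meeting_points \<C>"

lemma circleE:
  assumes "K \<in> \<C>"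
  obtains c r where "0 < r" "K = sphere c r"
  using assms circle_system by (auto simp: circle_system_def)

lemma in_two_circles: "K \<in> \<C> \<Longrightarrow> L \<in> \<C> \<Longrightarrow> p \<in> K \<Longrightarrow> p \<in> L \<Longrightarrow> p \<notin> M \<Longrightarrow> K = L"
  by (auto simp: meeting_points_def)

lemma circles_eq_if_three_common:
  assumes "K \<in> \<C>" "L \<in> \<C>" "{p, q, s} \<subseteq> K \<inter> L" "p \<noteq> q" "p \<noteq> s" "q \<noteq> s"
  shows "K = L"
proof -
  obtain c r where K: "K = sphere c r" using circleE[OF assms(1)] by blast
  obtain c' r' where L: "L = sphere c' r'" using circleE[OF assms(2)] by blast
  have "c = c'"
    using centres_eq_if_three_common[of p c r q s c' r'] assms K L by blast
  then show ?thesis using assms K L by auto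
qed

lemma arcE:
  assumes "g \<in> consecutive_arcs \<C>"
  obtains c r a b where "g = part_circlepath c r a b" "0 < r" "sphere c r \<in> \<C>"
    "0 < \<bar>b - a\<bar>" "\<bar>b - a\<bar> \<le> 2 * pi" "pathstart g \<in> M" "pathfinish g \<in> M"
    "\<And>t. 0 < t \<Longrightarrow> t < 1 \<Longrightarrow> g t \<notin> M"
  using assms unfolding consecutive_arcs_def by blast

lemma arcI:
  assumes "0 < r" "sphere c r \<in> \<C>" "0 < \<bar>b - a\<bar>" "\<bar>b - a\<bar> \<le> 2 * pi"
    "part_circlepath c r a b 0 \<in> M" "part_circlepath c r a b 1 \<in> M"
    "\<And>t. 0 < t \<Longrightarrow> t < 1 \<Longrightarrow> part_circlepath c r a b t \<notin> M"
  shows "part_circlepath c r a b \<in> consecutive_arcs \<C>"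
  unfolding consecutive_arcs_def using assms unfolding pathstart_def pathfinish_def by blast

text \<open>Meeting points within one turn in direction \<open>\<sigma>\<close> have finitely many
  parameters, \<open>2 * pi\<close> among them, and \<open>\<tau>\<close> is the least.\<close>

lemma next_arc:
  fixes \<sigma> :: real
  assumes K: "sphere c r \<in> \<C>" "0 < r" and M: "c + of_real r * cis \<theta> \<in> M" and \<sigma>: "\<bar>\<sigma>\<bar> = 1"
  obtains \<tau> where "0 < \<tau>" "\<tau> \<le> 2 * pi" "c + of_real r * cis (\<theta> + \<sigma> * \<tau>) \<in> M"
    "part_circlepath c r \<theta> (\<theta> + \<sigma> * \<tau>) \<in> consecutive_arcs \<C>"
    "\<And>t. 0 < t \<Longrightarrow> t < \<tau> \<Longrightarrow> c + of_real r * cis (\<theta> + \<sigma> * t) \<notin> M"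
proof -
  define f where "f t = c + of_real r * cis (\<theta> + \<sigma> * t)" for t
  define T where "T = {t. 0 < t \<and> t \<le> 2 * pi \<and> f t \<in> M}"
  have \<sigma>': "\<sigma> = 1 \<or> \<sigma> = - 1" using \<sigma> by auto
  \<comment> \<open>Omitting 0 and including \<open>2 * pi\<close> keeps parameters unique and lets
    a circle with a single meeting point yield a full loop.\<close>
  have "inj_on f {0<..2 * pi}"
  proof (rule inj_onI)
    fix s t assume st: "s \<in> {0<..2 * pi}" "t \<in> {0<..2 * pi}" "f s = f t"
    then have "cis (\<theta> + \<sigma> * s) = cis (\<theta> + \<sigma> * t)" using \<open>0 < r\<close> by (simp add: f_def)
    then obtain n :: int where n: "\<sigma> * s = \<sigma> * t + 2 * pi * of_int n"
      by (auto simp: cis_eq_iff_int)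
    then have "\<bar>2 * pi * of_int n\<bar> = \<bar>\<sigma> * (s - t)\<bar>" by (simp add: algebra_simps)
    also have "\<dots> < 2 * pi * 1" using st \<sigma> by (auto simp: abs_mult)
    finally have "\<bar>real_of_int n\<bar> < 1" by (simp add: abs_mult)
    then have "n = 0" by linarith
    then show "s = t" using n \<sigma>' by auto
  qed
  then have "finite (f -` M \<inter> {0<..2 * pi})" by (rule finite_vimage_IntI[OF finite_meeting])
  then have fin: "finite T" by (rule rev_finite_subset) (auto simp: T_def)
  have "cis (\<theta> + \<sigma> * (2 * pi)) = cis \<theta>"
    unfolding cis_eq_iff_int using \<sigma>' by (auto intro: exI[of _ 1] exI[of _ "- 1"])
  then have "f (2 * pi) = c + of_real r * cis \<theta>" by (simp add: f_def)
  then have "2 * pi \<in> T" using M by (simp add: T_def)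
  then have ne: "T \<noteq> {}" by blast
  define \<tau> where "\<tau> = Min T"
  have "\<tau> \<in> T" using fin ne by (simp add: \<tau>_def)
  then have \<tau>: "0 < \<tau>" "\<tau> \<le> 2 * pi" "f \<tau> \<in> M" by (auto simp: T_def)
  have min: "f t \<notin> M" if "0 < t" "t < \<tau>" for t
  proof
    assume "f t \<in> M"
    then have "t \<in> T" using that \<tau> by (auto simp: T_def)
    then show False using Min_le[OF fin, of t] that by (simp add: \<tau>_def)
  qed
  have "part_circlepath c r \<theta> (\<theta> + \<sigma> * \<tau>) t = f (t * \<tau>)" for t
    by (simp add: part_circlepath_cis f_def algebra_simps)
  moreover have "f (t * \<tau>) \<notin> M" if "0 < t" "t < 1" for t
    using that \<tau> by (intro min) auto
  moreover have "f 0 \<in> M" using M by (simp add: f_def)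
  ultimately have "part_circlepath c r \<theta> (\<theta> + \<sigma> * \<tau>) \<in> consecutive_arcs \<C>"
    using K \<tau> \<sigma> by (intro arcI) (simp_all add: abs_mult)
  then show ?thesis using that[of \<tau>] \<tau> min by (simp add: f_def)
qed

lemma arc_on_circle:
  assumes g: "g \<in> consecutive_arcs \<C>" and K: "sphere c r \<in> \<C>" "0 < r" and half: "g (1 / 2) \<in> sphere c r"
  obtains a b where "g = part_circlepath c r a b" "0 < \<bar>b - a\<bar>" "\<bar>b - a\<bar> \<le> 2 * pi"
proof -
  obtain c' r' a b where g': "g = part_circlepath c' r' a b" "0 < r'" "sphere c' r' \<in> \<C>"
    "0 < \<bar>b - a\<bar>" "\<bar>b - a\<bar> \<le> 2 * pi" "\<And>t. 0 < t \<Longrightarrow> t < 1 \<Longrightarrow> g t \<notin> M"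
    using arcE[OF g] by metis
  have "g (1 / 2) \<in> sphere c' r'" using g'(1,2) by (simp add: part_circlepath_cis del: mem_sphere)
  then have "sphere c' r' = sphere c r" using in_two_circles[OF g'(3) K(1) _ half] g'(6) by simp
  then have "c' = c" "r' = r" using sphere_inject g'(2) by auto
  then show ?thesis using that g' by blast
qed

text \<open>The midpoint of an arc is no meeting point, hence lies on one circle only and identifies
  it.\<close>

definition circle_of :: "(real \<Rightarrow> complex) \<Rightarrow> complex set" where
  "circle_of g = (THE K. K \<in> \<C> \<and> g (1 / 2) \<in> K)"

lemma circle_of_eqI:
  assumes g: "g \<in> consecutive_arcs \<C>" and K: "K \<in> \<C>" "g (1 / 2) \<in> K"
  shows "circle_of g = K"
  unfolding circle_of_def
proof (rule the_equality)
  show "K \<in> \<C> \<and> g (1 / 2) \<in> K" using K by simp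
  have "g (1 / 2) \<notin> M" by (rule arcE[OF g]) simp
  then show "L = K" if "L \<in> \<C> \<and> g (1 / 2) \<in> L" for L using that K in_two_circles by blast
qed

lemma circle_of:
  assumes g: "g \<in> consecutive_arcs \<C>"
  shows "circle_of g \<in> \<C>" "path_image g \<subseteq> circle_of g" "pathstart g \<in> circle_of g"
    "pathfinish g \<in> circle_of g" "g (1 / 2) \<in> circle_of g"
proof -
  obtain c r a b where g': "g = part_circlepath c r a b" "0 < r" "sphere c r \<in> \<C>"
    using arcE[OF g] by metis
  have sub: "path_image g \<subseteq> sphere c r" using g'(1,2) path_image_part_circlepath_subset' by simp
  have "g (1 / 2) \<in> path_image g" by (simp add: path_image_def)
  then have "circle_of g = sphere c r" using sub g'(3) circle_of_eqI[OF g] by blast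
  then show "circle_of g \<in> \<C>" "path_image g \<subseteq> circle_of g" "pathstart g \<in> circle_of g"
    "pathfinish g \<in> circle_of g" "g (1 / 2) \<in> circle_of g"
    using sub g'(3) \<open>g (1 / 2) \<in> path_image g\<close> pathstart_in_path_image pathfinish_in_path_image by auto
qed

lemma reversepath_arc:
  assumes g: "g \<in> consecutive_arcs \<C>"
  shows "reversepath g \<in> consecutive_arcs \<C>" "circle_of (reversepath g) = circle_of g"
proof -
  obtain c r a b where g': "g = part_circlepath c r a b" "0 < r" "sphere c r \<in> \<C>"
    "0 < \<bar>b - a\<bar>" "\<bar>b - a\<bar> \<le> 2 * pi" "pathstart g \<in> M" "pathfinish g \<in> M"
    "\<And>t. 0 < t \<Longrightarrow> t < 1 \<Longrightarrow> g t \<notin> M"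
    using arcE[OF g] by metis
  have "reversepath g t \<notin> M" if "0 < t" "t < 1" for t
    using g'(8)[of "1 - t"] that by (simp add: reversepath_def)
  moreover have eq: "reversepath g = part_circlepath c r b a" by (simp add: g'(1))
  moreover have "reversepath g 0 \<in> M" "reversepath g 1 \<in> M"
    using g'(6,7) by (simp_all add: reversepath_def pathstart_def pathfinish_def)
  ultimately have "part_circlepath c r b a \<in> consecutive_arcs \<C>"
    using g'(2-5) by (intro arcI) (simp_all add: abs_minus_commute)
  then show rev: "reversepath g \<in> consecutive_arcs \<C>" by (simp only: eq)
  show "circle_of (reversepath g) = circle_of g"
    using circle_of[OF g] by (intro circle_of_eqI[OF rev]) (auto simp: reversepath_def)
qed

text \<open>One arc leaves \<open>p\<close> counterclockwise and one clockwise, each up to the next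
  meeting point.\<close>

lemma card_arcs_at_meeting_point:
  assumes K: "K \<in> \<C>" and p: "p \<in> K" "p \<in> M"
  shows "card {g \<in> consecutive_arcs \<C>. pathstart g = p \<and> circle_of g = K} = 2"
proof -
  obtain c r where cr: "0 < r" "K = sphere c r" using circleE[OF K] .
  obtain \<theta> where \<theta>: "p = c + of_real r * cis \<theta>" using sphere_cis p(1) cr by blast
  have M: "c + of_real r * cis \<theta> \<in> M" using p \<theta> by simp
  have K': "sphere c r \<in> \<C>" using K cr by simp
  obtain s where s: "0 < s" "s \<le> 2 * pi" "c + of_real r * cis (\<theta> + 1 * s) \<in> M"
    "part_circlepath c r \<theta> (\<theta> + 1 * s) \<in> consecutive_arcs \<C>"
    "\<And>t. 0 < t \<Longrightarrow> t < s \<Longrightarrow> c + of_real r * cis (\<theta> + 1 * t) \<notin> M"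
    using next_arc[OF K' cr(1) M, of 1] by (metis abs_one)
  obtain s' where s': "0 < s'" "s' \<le> 2 * pi" "c + of_real r * cis (\<theta> + - 1 * s') \<in> M"
    "part_circlepath c r \<theta> (\<theta> + - 1 * s') \<in> consecutive_arcs \<C>"
    "\<And>t. 0 < t \<Longrightarrow> t < s' \<Longrightarrow> c + of_real r * cis (\<theta> + - 1 * t) \<notin> M"
    using next_arc[OF K' cr(1) M, of "- 1"] by (metis abs_one abs_minus_cancel)
  let ?g = "part_circlepath c r \<theta> (\<theta> + 1 * s)" and ?h = "part_circlepath c r \<theta> (\<theta> + - 1 * s')"
  have "?g \<noteq> ?h"
  proof
    assume "?g = ?h"
    \<comment> \<open>At 1/4 the angles differ by at most \<open>pi\<close>. At 1/2 the two opposite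
      loops of a circle with a single meeting point would agree.\<close>
    then have "?g (1 / 4) = ?h (1 / 4)" by simp
    then have "cis (\<theta> + s / 4) = cis (\<theta> - s' / 4)" using cr(1) by (simp add: part_circlepath_cis)
    then obtain n :: int where "\<theta> + s / 4 = \<theta> - s' / 4 + 2 * pi * of_int n"
      by (auto simp: cis_eq_iff_int)
    then have n: "(s + s') / 4 = 2 * pi * of_int n" by (simp add: add_divide_distrib)
    have "0 < 2 * pi * of_int n" unfolding n[symmetric] using s(1) s'(1) by simp
    moreover have "s + s' < 8 * pi" using s(2) s'(2) pi_gt_zero by linarith
    then have "2 * pi * of_int n < 2 * pi * 1" unfolding n[symmetric] by simp
    ultimately have "0 < real_of_int n" "real_of_int n < 1"
      by (simp_all add: zero_less_mult_iff)
    then show False by simp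
  qed
  moreover have "{g \<in> consecutive_arcs \<C>. pathstart g = p \<and> circle_of g = K} = {?g, ?h}"
  proof (intro equalityI subsetI)
    fix g assume "g \<in> {g \<in> consecutive_arcs \<C>. pathstart g = p \<and> circle_of g = K}"
    then have g: "g \<in> consecutive_arcs \<C>" "pathstart g = p" "circle_of g = K" by auto
    have "g (1 / 2) \<in> sphere c r" using circle_of(5)[OF g(1)] g(3) cr by simp
    then obtain a b where ab: "g = part_circlepath c r a b" "0 < \<bar>b - a\<bar>" "\<bar>b - a\<bar> \<le> 2 * pi"
      using arc_on_circle[OF g(1) K' cr(1)] by blast
    have inner: "g t \<notin> M" if "0 < t" "t < 1" for t using arcE[OF g(1)] that by metis
    have "pathfinish g \<in> M" using arcE[OF g(1)] by metis
    have "cis a = cis \<theta>"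
      using g(2) ab(1) \<theta> cr(1) by (simp add: cis_conv_exp)
    then obtain n :: int where n: "a = \<theta> + 2 * pi * of_int n" by (auto simp: cis_eq_iff_int)
    define d where "d = b - a"
    have gt: "g t = c + of_real r * cis (\<theta> + t * d)" for t
    proof -
      have "cis (a + t * d) = cis (\<theta> + t * d)" unfolding cis_eq_iff_int using n by auto
      then show ?thesis by (simp add: ab(1) part_circlepath_cis d_def)
    qed
    have last: "c + of_real r * cis (\<theta> + d) \<in> M"
      using \<open>pathfinish g \<in> M\<close> gt[of 1] by (simp add: pathfinish_def)
    have g_eq: "g = part_circlepath c r \<theta> (\<theta> + d)"
      by (rule ext) (simp add: gt part_circlepath_cis)
    have scaled: "c + of_real r * cis (\<theta> + x * d) \<notin> M" if "0 < x" "x < 1" for x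
      using inner[OF that] gt by simp
    show "g \<in> {?g, ?h}"
    \<comment> \<open>A longer arc would have the next meeting point in its interior; a shorter one
      would end at a meeting point before it.\<close>
    proof (cases "d > 0")
      case True
      have "\<not> s < d" using scaled[of "s / d"] s True by auto
      moreover have "\<not> d < s" using s(5)[of d] True last by auto
      ultimately show ?thesis using g_eq by simp
    next
      case False
      then have neg: "d < 0" using ab(2) by (auto simp: d_def)
      have "\<not> s' < - d" using scaled[of "s' / - d"] s' neg by (auto simp: field_simps)
      moreover have "\<not> - d < s'" using s'(5)[of "- d"] neg last by auto
      ultimately have "d = - s'" by simp
      then show ?thesis using g_eq by simp
    qed
  next
    fix g assume "g \<in> {?g, ?h}"
    then have g: "g \<in> consecutive_arcs \<C>" using s(4) s'(4) by auto
    have "pathstart g = p" using \<open>g \<in> {?g, ?h}\<close> \<theta> by (auto simp: cis_conv_exp)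
    moreover have "g (1 / 2) \<in> K"
      using \<open>g \<in> {?g, ?h}\<close> cr by (auto simp: part_circlepath_cis simp del: mem_sphere)
    ultimately show "g \<in> {g \<in> consecutive_arcs \<C>. pathstart g = p \<and> circle_of g = K}"
      using g circle_of_eqI[OF g K] by simp
  qed
  ultimately show ?thesis by simp
qed

text \<open>A counterclockwise walk from \<open>p\<close> stays in \<open>S\<close> at meeting
  points. Its last such parameter up to \<open>T\<close> is \<open>T\<close> itself, since no arc
  jumps over the meeting point \<open>q\<close>.\<close>

lemma circle_connected_by_arcs:
  assumes K: "K \<in> \<C>" and p: "p \<in> S" "p \<in> K" "p \<in> M"
    and closed: "\<And>g. g \<in> consecutive_arcs \<C> \<Longrightarrow> circle_of g = K \<Longrightarrow> pathstart g \<in> S \<Longrightarrow> pathfinish g \<in> S"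
  shows "K \<inter> M \<subseteq> S"
proof
  fix q assume q: "q \<in> K \<inter> M"
  obtain c r where cr: "0 < r" "K = sphere c r" using circleE[OF K] .
  have K': "sphere c r \<in> \<C>" using K cr by simp
  obtain \<theta> where \<theta>: "p = c + of_real r * cis \<theta>" using sphere_cis p cr by blast
  define f where "f t = c + of_real r * cis (\<theta> + t)" for t
  have step: "\<exists>\<tau>. 0 < \<tau> \<and> f (t + \<tau>) \<in> S \<and> f (t + \<tau>) \<in> M \<and> (\<forall>x. 0 < x \<and> x < \<tau> \<longrightarrow> f (t + x) \<notin> M)"
    if t: "f t \<in> S" "f t \<in> M" for t
  proof -
    have "c + of_real r * cis (\<theta> + t) \<in> M" using t by (simp add: f_def)
    then obtain \<tau> where \<tau>: "0 < \<tau>" "c + of_real r * cis (\<theta> + t + 1 * \<tau>) \<in> M"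
      "part_circlepath c r (\<theta> + t) (\<theta> + t + 1 * \<tau>) \<in> consecutive_arcs \<C>"
      "\<And>x. 0 < x \<Longrightarrow> x < \<tau> \<Longrightarrow> c + of_real r * cis (\<theta> + t + 1 * x) \<notin> M"
      using next_arc[OF K' cr(1), of "\<theta> + t" 1] by (metis abs_one)
    let ?g = "part_circlepath c r (\<theta> + t) (\<theta> + t + 1 * \<tau>)"
    have "circle_of ?g = K"
      using cr by (intro circle_of_eqI[OF \<tau>(3) K]) (simp add: part_circlepath_cis del: mem_sphere)
    moreover have "pathstart ?g = f t" "pathfinish ?g = f (t + \<tau>)"
      by (simp_all add: f_def cis_conv_exp algebra_simps)
    ultimately have "f (t + \<tau>) \<in> S" using closed[OF \<tau>(3)] t by metis
    then show ?thesis using \<tau> by (intro exI[of _ \<tau>]) (auto simp: f_def add.assoc)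
  qed
  obtain \<phi> where \<phi>: "q = c + of_real r * cis \<phi>" using sphere_cis q cr by blast
  \<comment> \<open>Whole turns are added so that \<open>q\<close> comes after \<open>p\<close> on
    the walk.\<close>
  obtain n :: nat where n: "\<theta> - \<phi> < of_nat n * (2 * pi)"
    using ex_less_of_nat_mult[of "2 * pi" "\<theta> - \<phi>"] by auto
  define T where "T = \<phi> - \<theta> + of_nat n * (2 * pi)"
  have T: "0 < T" "f T = q"
  proof -
    show "0 < T" using n by (simp add: T_def)
    have "\<theta> + T = \<phi> + 2 * pi * of_int (int n)" by (simp add: T_def)
    then have "cis (\<theta> + T) = cis \<phi>" unfolding cis_eq_iff_int by blast
    then show "f T = q" by (simp add: f_def \<phi>)
  qed
  define A where "A = {t. 0 \<le> t \<and> t \<le> T \<and> f t \<in> S \<and> f t \<in> M}"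
  have "0 \<in> A" using p T by (simp add: A_def f_def \<theta>)
  have bdd: "bdd_above A" by (auto simp: A_def bdd_above_def)
  define s where "s = Sup A"
  have "s \<in> A"
  proof -
    \<comment> \<open>\<open>S \<inter> M\<close> is finite, hence closed, so the supremum of
      \<open>A\<close> is attained.\<close>
    have "closed A"
    proof -
      have "isCont f x" for x unfolding f_def cis_conv_exp by (intro continuous_intros)
      moreover have "closed (S \<inter> M)" using finite_meeting by (simp add: finite_imp_closed)
      ultimately have "closed (f -` (S \<inter> M))" by (intro continuous_closed_vimage)
      moreover have "A = {0..T} \<inter> f -` (S \<inter> M)" by (auto simp: A_def)
      ultimately show ?thesis by auto
    qed
    then show ?thesis unfolding s_def
      using closed_contains_Sup[OF _ bdd] \<open>0 \<in> A\<close> by blast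
  qed
  then have s: "0 \<le> s" "s \<le> T" "f s \<in> S" "f s \<in> M" by (auto simp: A_def)
  obtain \<tau> where \<tau>: "0 < \<tau>" "f (s + \<tau>) \<in> S" "f (s + \<tau>) \<in> M"
    "\<And>x. 0 < x \<Longrightarrow> x < \<tau> \<Longrightarrow> f (s + x) \<notin> M"
    using step[OF s(3,4)] by blast
  have "s = T"
  proof (rule ccontr)
    assume "s \<noteq> T"
    then have "\<not> T - s < \<tau>" using \<tau>(4)[of "T - s"] T q s by auto
    then have "s + \<tau> \<in> A" using \<tau> s by (auto simp: A_def)
    then have "s + \<tau> \<le> s" unfolding s_def using cSup_upper[OF _ bdd] by (metis s_def)
    then show False using \<tau>(1) by simp
  qed
  then show "q \<in> S" using s T by simp
qed

end

section \<open>Colouring the edges of a realized graph by its circles\<close>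

lemma card_four_filter:
  assumes "distinct [a, b, c, d]"
  shows "card {n \<in> {a, b, c, d}. P n} =
    of_bool (P a) + of_bool (P b) + of_bool (P c) + (of_bool (P d) :: nat)"
proof -
  have "card {n \<in> {a, b, c, d}. P n} = (\<Sum>n \<in> {a, b, c, d}. if P n then 1 else 0)"
    by (simp only: card_eq_sum sum.inter_filter finite.emptyI finite.insertI)
  then show ?thesis using assms by simp
qed

locale realized_graph = circle_arrangement +
  fixes V :: "'a set" and nb :: "'a \<Rightarrow> 'a set" and \<phi> :: "'a \<Rightarrow> complex"
    and \<gamma> :: "'a \<Rightarrow> 'a \<Rightarrow> real \<Rightarrow> complex"
  assumes inj: "inj_on \<phi> V"
    and verts: "\<phi> ` V = meeting_points \<C>"
    and nb_subset: "v \<in> V \<Longrightarrow> nb v \<subseteq> V"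
    and arcs: "consecutive_arcs \<C> = {\<gamma> u v | u v. u \<in> V \<and> v \<in> nb u}"
    and start: "u \<in> V \<Longrightarrow> v \<in> nb u \<Longrightarrow> pathstart (\<gamma> u v) = \<phi> u"
    and finish: "u \<in> V \<Longrightarrow> v \<in> nb u \<Longrightarrow> pathfinish (\<gamma> u v) = \<phi> v"
begin

definition col :: "'a \<Rightarrow> 'a \<Rightarrow> complex set" where
  "col u v = circle_of (\<gamma> u v)"

lemma arc_mem: "u \<in> V \<Longrightarrow> v \<in> nb u \<Longrightarrow> \<gamma> u v \<in> consecutive_arcs \<C>"
  using arcs by blast

lemma phi_eq_iff: "u \<in> V \<Longrightarrow> v \<in> V \<Longrightarrow> \<phi> u = \<phi> v \<longleftrightarrow> u = v"
  using inj by (auto simp: inj_on_def)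

lemma col_circle:
  assumes "u \<in> V" "v \<in> nb u"
  shows "col u v \<in> \<C>" "\<phi> u \<in> col u v" "\<phi> v \<in> col u v"
  using circle_of[OF arc_mem[OF assms]] start[OF assms] finish[OF assms] by (auto simp: col_def)

text \<open>The reversed arc belongs to the system, and its end points identify it as
  \<open>\<gamma> v u\<close>.\<close>

lemma col_commute:
  assumes "u \<in> V" "v \<in> nb u"
  shows "col v u = col u v"
proof -
  obtain a b where ab: "reversepath (\<gamma> u v) = \<gamma> a b" "a \<in> V" "b \<in> nb a"
    using reversepath_arc(1)[OF arc_mem[OF assms]] arcs by auto
  have "\<phi> a = \<phi> v" "\<phi> b = \<phi> u"
    using start[OF ab(2,3)] finish[OF ab(2,3)] start[OF assms] finish[OF assms] ab(1)
    by (metis pathstart_reversepath, metis pathfinish_reversepath)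
  then have "a = v" "b = u" using phi_eq_iff nb_subset assms ab by blast+
  then show ?thesis using reversepath_arc(2)[OF arc_mem[OF assms]] ab(1) by (simp add: col_def)
qed

lemma card_col:
  assumes "v \<in> V" "K \<in> \<C>" "\<phi> v \<in> K"
  shows "card {n \<in> nb v. col v n = K} = 2"
proof -
  have "\<gamma> v ` {n \<in> nb v. col v n = K} = {g \<in> consecutive_arcs \<C>. pathstart g = \<phi> v \<and> circle_of g = K}"
  proof (intro equalityI subsetI)
    fix g assume "g \<in> {g \<in> consecutive_arcs \<C>. pathstart g = \<phi> v \<and> circle_of g = K}"
    then obtain a n where g: "g = \<gamma> a n" "a \<in> V" "n \<in> nb a" "pathstart g = \<phi> v" "circle_of g = K"
      using arcs by auto
    then have "a = v" using start[of a n] phi_eq_iff assms(1) by simp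
    then show "g \<in> \<gamma> v ` {n \<in> nb v. col v n = K}" using g by (auto simp: col_def)
  qed (use assms(1) start arc_mem in \<open>auto simp: col_def\<close>)
  moreover have "inj_on (\<gamma> v) {n \<in> nb v. col v n = K}"
    using finish[OF assms(1)] phi_eq_iff nb_subset[OF assms(1)] by (intro inj_onI) (metis mem_Collect_eq subsetD)
  moreover have "\<phi> v \<in> M" using verts assms(1) by blast
  ultimately show ?thesis
    using card_arcs_at_meeting_point[OF assms(2,3)] card_image by metis
qed

lemma even_card_col:
  assumes "v \<in> V"
  shows "even (card {n \<in> nb v. col v n = K})"
proof (cases "\<exists>n \<in> nb v. col v n = K")
  case True
  then show ?thesis using card_col[of v K] col_circle assms by force
next
  case False
  then have "{n \<in> nb v. col v n = K} = {}" by blast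
  then show ?thesis by (simp only: card.empty) simp
qed

text \<open>By \<open>card_col\<close> every colour present at \<open>v\<close> occurs exactly
  twice, which leaves the three ways to pair four edges.\<close>

lemma col_at_vertex:
  assumes "v \<in> V" "nb v = {a, b, c, d}" "distinct [a, b, c, d]"
  shows "(col v a = col v b \<and> col v c = col v d \<and> col v a \<noteq> col v c) \<or>
    (col v a = col v c \<and> col v b = col v d \<and> col v a \<noteq> col v b) \<or>
    (col v a = col v d \<and> col v b = col v c \<and> col v a \<noteq> col v b)"
proof -
  have two: "of_bool (col v a = col v n) + of_bool (col v b = col v n) + of_bool (col v c = col v n) +
    of_bool (col v d = col v n) = (2 :: nat)" if "n \<in> nb v" for n
  proof -
    have "card {m \<in> {a, b, c, d}. col v m = col v n} = 2"
      using card_col[OF assms(1) col_circle(1,2)[OF assms(1) that]] assms(2) by simp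
    then show ?thesis using card_four_filter[OF assms(3), of "\<lambda>m. col v m = col v n"] by simp
  qed
  have "a \<in> nb v" "b \<in> nb v" "c \<in> nb v" using assms(2) by auto
  note two[OF this(1)] two[OF this(2)] two[OF this(3)]
  then show ?thesis
    by (cases "col v a = col v b"; cases "col v a = col v c"; cases "col v a = col v d";
        cases "col v b = col v c"; cases "col v b = col v d"; cases "col v c = col v d") simp_all
qed

lemma col_pair:
  assumes "v \<in> V" "nb v = {a, b, c, d}" "distinct [a, b, c, d]" "col v c = col v d"
  shows "col v a = col v b" "col v a \<noteq> col v c" "col v b \<noteq> col v c"
  using col_at_vertex[OF assms(1-3)] assms(4) by metis+

text \<open>All vertices on \<open>K\<close> are reached from \<open>s\<close> along edges of colour
  \<open>K\<close>, so a circle can be bounded combinatorially.\<close>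

lemma circle_vertices_subset:
  assumes "K \<in> \<C>" "S \<subseteq> V" "s \<in> S" "\<phi> s \<in> K"
    and "\<And>u n. u \<in> S \<Longrightarrow> n \<in> nb u \<Longrightarrow> col u n = K \<Longrightarrow> n \<in> S"
  shows "{v \<in> V. \<phi> v \<in> K} \<subseteq> S"
proof -
  have "K \<inter> M \<subseteq> \<phi> ` S"
  proof (rule circle_connected_by_arcs[OF assms(1)])
    show "\<phi> s \<in> \<phi> ` S" "\<phi> s \<in> K" "\<phi> s \<in> M" using assms(2-4) verts by auto
    fix g assume g: "g \<in> consecutive_arcs \<C>" "circle_of g = K" "pathstart g \<in> \<phi> ` S"
    then obtain u n where un: "g = \<gamma> u n" "u \<in> V" "n \<in> nb u" using arcs by auto
    then have "u \<in> S" using g(3) start phi_eq_iff assms(2) by (metis imageE subsetD)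
    then have "n \<in> S" using assms(5) g(2) un by (simp add: col_def)
    then show "pathfinish g \<in> \<phi> ` S" using un finish by auto
  qed
  show ?thesis
  proof
    fix v assume "v \<in> {v \<in> V. \<phi> v \<in> K}"
    then have v: "v \<in> V" "\<phi> v \<in> K" by auto
    then have "\<phi> v \<in> K \<inter> M" using verts by blast
    then obtain s where "s \<in> S" "\<phi> v = \<phi> s" using \<open>K \<inter> M \<subseteq> \<phi> ` S\<close> by blast
    then show "v \<in> S" using phi_eq_iff[OF v(1)] assms(2) by blast
  qed
qed

text \<open>A block that is attached at the single vertex \<open>w\<close>: counting the arcs of one circle at the
  vertices of the block gives an even number of them leaving the block.\<close>

lemma pendant_block_col:
  assumes V: "{w, x, y, x', y', z, z'} \<subseteq> V" and "distinct [w, x, y, x', y', z, z']"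
    and nb: "nb x = {w, y', z, z'}" "nb y = {w, x', z, z'}" "nb x' = {y, y', z, z'}"
      "nb y' = {x, x', z, z'}" "nb z = {x, y, x', y'}" "nb z' = {x, y, x', y'}"
  shows "col x w = col y w"
proof -
  define e where "e p q = (of_bool (col p q = col x w) :: nat)" for p q
  have ev: "even (e v a + e v b + e v c + e v d)"
    if "v \<in> V" "nb v = {a, b, c, d}" "distinct [a, b, c, d]" for v a b c d
    using even_card_col[OF that(1), of "col x w"] card_four_filter[OF that(3), of "\<lambda>n. col v n = col x w"]
    by (simp add: that(2) e_def)
  have sym: "e y' x = e x y'" "e z x = e x z" "e z' x = e x z'" "e x' y = e y x'" "e z y = e y z"
    "e z' y = e y z'" "e y' x' = e x' y'" "e z x' = e x' z" "e z' x' = e x' z'" "e z y' = e y' z"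
    "e z' y' = e y' z'"
    unfolding e_def using V nb by (simp_all add: col_commute)
  have V': "x \<in> V" "y \<in> V" "x' \<in> V" "y' \<in> V" "z \<in> V" "z' \<in> V" using V by simp_all
  have "even ((e x w + e x y' + e x z + e x z') + (e y w + e y x' + e y z + e y z') +
    (e x' y + e x' y' + e x' z + e x' z') + (e y' x + e y' x' + e y' z + e y' z') +
    (e z x + e z y + e z x' + e z y') + (e z' x + e z' y + e z' x' + e z' y'))"
    by (rule dvd_add[OF dvd_add[OF dvd_add[OF dvd_add[OF dvd_add[OF ev[OF V'(1) nb(1)]
          ev[OF V'(2) nb(2)]] ev[OF V'(3) nb(3)]] ev[OF V'(4) nb(4)]] ev[OF V'(5) nb(5)]]
          ev[OF V'(6) nb(6)]]) (use assms(2) in auto)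
  also have "(e x w + e x y' + e x z + e x z') + (e y w + e y x' + e y z + e y z') +
    (e x' y + e x' y' + e x' z + e x' z') + (e y' x + e y' x' + e y' z + e y' z') +
    (e z x + e z y + e z x' + e z y') + (e z' x + e z' y + e z' x' + e z' y') =
    e x w + e y w + 2 * (e x y' + e x z + e x z' + e y x' + e y z + e y z' + e x' y' + e x' z +
      e x' z' + e y' z + e y' z')"
    by (simp add: sym)
  finally have "even (e x w + e y w)" by simp
  \<comment> \<open>\<open>e x w\<close> is 1 by definition, so \<open>e y w\<close> is odd.\<close>
  then show ?thesis by (auto simp: e_def of_bool_def split: if_splits)
qed

text \<open>Otherwise the two circles through \<open>u\<close> both pass through \<open>u\<close>, \<open>m\<close> and \<open>v\<close>.\<close>

lemma chain_col:
  assumes V: "{u, m, v, w, w'} \<subseteq> V" and dist: "distinct [u, m, v]" "distinct [u, w, v, w']"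
    and nb: "m \<in> nb u" "w \<in> nb u" "nb m = {u, w, v, w'}" "{u, m} \<subseteq> nb w" "{v, m} \<subseteq> nb w'"
    and w: "col w u = col w m" "col w' v = col w' m"
  shows "col u m = col u w"
proof (rule ccontr)
  assume neq: "col u m \<noteq> col u w"
  have V': "u \<in> V" "m \<in> V" "v \<in> V" "w \<in> V" "w' \<in> V" using V by auto
  have mu: "col m u = col u m" using col_commute V' nb(1) by blast
  have mw: "col m w = col u w" using col_commute[of w m] col_commute[of w u] V' nb(4) w(1) by auto
  \<comment> \<open>Both circles continue from \<open>m\<close> to \<open>v\<close>, one along the
    edge and one through \<open>w'\<close>, in either assignment.\<close>
  have "(col m v = col u m \<and> col m w' = col u w) \<or> (col m v = col u w \<and> col m w' = col u m)"
    using col_at_vertex[OF V'(2) nb(3) dist(2)] mu mw neq by auto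
  moreover have "\<phi> v \<in> col m v" using col_circle V' nb(3) by blast
  moreover have "\<phi> v \<in> col m w'"
    using col_circle(3)[of w' v] col_commute[of w' m] V' nb(5) w(2) by auto
  ultimately have "\<phi> v \<in> col u m" "\<phi> v \<in> col u w" by auto
  moreover have "\<phi> u \<in> col u m" "\<phi> m \<in> col u m" "\<phi> u \<in> col u w" using col_circle V' nb(1,2) by blast+
  moreover have "\<phi> m \<in> col u w" using col_circle(2)[of m w] mw V' nb(3) by auto
  moreover have "col u m \<in> \<C>" "col u w \<in> \<C>" using col_circle V' nb(1,2) by blast+
  moreover have "\<phi> u \<noteq> \<phi> m" "\<phi> u \<noteq> \<phi> v" "\<phi> m \<noteq> \<phi> v" using phi_eq_iff V' dist(1) by auto
  ultimately show False using circles_eq_if_three_common[of "col u m" "col u w" "\<phi> u" "\<phi> m" "\<phi> v"] neq by blast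
qed

text \<open>At each of the three vertices the edges of the triangle use up both places of this
  colour, so the circle closes up.\<close>

lemma digon_circle_vertices:
  assumes V: "{u, m, w} \<subseteq> V"
    and nb: "nb u = {a, b, m, w}" "nb m = {u, w, v, w'}" "nb w = {u, m, x, y}"
    and dist: "distinct [a, b, m, w]" "distinct [u, w, v, w']" "distinct [u, m, x, y]"
    and u: "col u m = col u w" and w: "col w u = col w m"
  shows "{t \<in> V. \<phi> t \<in> col u m} = {u, m, w}"
proof
  have V': "u \<in> V" "m \<in> V" "w \<in> V" using V by auto
  have mu: "col m u = col u m" using col_commute V' nb(1) by blast
  have wu: "col w u = col u m" using col_commute[of u w] V' nb(1) u by auto
  have mw: "col m w = col u m" using col_commute[of w m] V' nb(3) w wu by auto
  show "{t \<in> V. \<phi> t \<in> col u m} \<subseteq> {u, m, w}"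
  proof (rule circle_vertices_subset)
    show "col u m \<in> \<C>" "\<phi> u \<in> col u m" using col_circle V' nb(1) by blast+
    fix s n assume s: "s \<in> {u, m, w}" "n \<in> nb s" "col s n = col u m"
    have "nb m = {v, w', u, w}" "nb w = {x, y, u, m}" using nb by auto
    moreover have "distinct [v, w', u, w]" "distinct [x, y, u, m]" using dist by auto
    ultimately have "col m v \<noteq> col m u" "col m w' \<noteq> col m u" "col w x \<noteq> col w u" "col w y \<noteq> col w u"
      using col_pair[OF V'(2), of v w' u w] col_pair[OF V'(3), of x y u m] w mu mw by auto
    then show "n \<in> {u, m, w}"
      using s col_pair(2,3)[OF V'(1) nb(1) dist(1) u] nb mu wu by auto
  qed (use V in auto)
  show "{u, m, w} \<subseteq> {t \<in> V. \<phi> t \<in> col u m}"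
    using V' col_circle[of u m] col_circle(3)[of u w] nb(1) u by auto
qed

end

subsection \<open>The graph and a plane drawing of it\<close>

text \<open>Vertices: \<open>j < 8\<close> are the vertices of the 8-cycle, \<open>8, \<dots>, 11\<close> the middle vertices of the chains,
  \<open>12 + j\<close> subdivides the digon at \<open>j\<close>, and \<open>20 + 6 * j, \<dots>, 25 + 6 * j\<close> form its pendant block,
  an octahedron with antipodal pairs \<open>{0, 2}, {1, 3}, {4, 5}\<close> (offsets) in which the edge \<open>{0, 1}\<close>
  is replaced by a path through \<open>12 + j\<close>.\<close>

definition partner :: "nat \<Rightarrow> nat" where
  "partner j = [3, 6, 5, 0, 7, 2, 1, 4] ! j"

definition mid :: "nat \<Rightarrow> nat" where
  "mid j = [10, 8, 9, 10, 11, 9, 8, 11] ! j"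

definition block_nbr :: "nat \<Rightarrow> nat list" where
  "block_nbr k = [[3, 4, 5], [2, 4, 5], [1, 3, 4, 5], [0, 2, 4, 5], [0, 1, 2, 3], [0, 1, 2, 3]] ! k"

definition nbr :: "nat \<Rightarrow> nat list" where
  "nbr v =
    (if v < 8 then [(v + 1) mod 8, (v + 7) mod 8, mid v, 12 + v]
     else if v < 12 then (let j = [1, 2, 0, 4] ! (v - 8) in [j, 12 + j, partner j, 12 + partner j])
     else if v < 20 then [v - 12, mid (v - 12), 20 + 6 * (v - 12), 21 + 6 * (v - 12)]
     else (let j = (v - 20) div 6; k = (v - 20) mod 6
           in (if k < 2 then [12 + j] else []) @ map (\<lambda>i. 20 + 6 * j + i) (block_nbr k)))"

definition chain_graph :: "(nat, nat \<times> nat) pre_digraph" where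
  "chain_graph =
     \<lparr>verts = {..<68}, arcs = {(u, v). u < 68 \<and> v \<in> set (nbr u)}, tail = fst, head = snd\<rparr>"

text \<open>A finite evaluation. The smaller neighbour of each nonzero vertex yields connectedness
  by descent to 0.\<close>

lemma nbr_check:
  "\<forall>u \<in> set [0..<68]. length (nbr u) = 4 \<and> distinct (nbr u) \<and>
     (\<forall>v \<in> set (nbr u). v < 68 \<and> v \<noteq> u \<and> u \<in> set (nbr v)) \<and>
     (u = 0 \<or> (\<exists>v \<in> set (nbr u). v < u))"
  by code_simp

lemma length_nbr: "u < 68 \<Longrightarrow> length (nbr u) = 4"
  and distinct_nbr: "u < 68 \<Longrightarrow> distinct (nbr u)"
  and nbr_less: "u < 68 \<Longrightarrow> v \<in> set (nbr u) \<Longrightarrow> v < 68"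
  and nbr_irrefl: "u < 68 \<Longrightarrow> v \<in> set (nbr u) \<Longrightarrow> v \<noteq> u"
  and nbr_sym: "u < 68 \<Longrightarrow> v \<in> set (nbr u) \<Longrightarrow> u \<in> set (nbr v)"
  and nbr_descend: "u < 68 \<Longrightarrow> u \<noteq> 0 \<Longrightarrow> \<exists>v \<in> set (nbr u). v < u"
  using nbr_check[unfolded set_upt, rule_format, of u] by auto

lemma graph_chain_graph: "graph chain_graph"
proof
  show "finite (arcs chain_graph)"
    by (rule finite_subset[of _ "{..<68} \<times> {..<68}"])
       (auto simp: chain_graph_def dest: nbr_less)
qed (auto simp: chain_graph_def symmetric_def sym_def arcs_ends_def arc_to_ends_def image_iff
       prod_eq_iff dest: nbr_less nbr_irrefl nbr_sym)

lemma regular_chain_graph: "regular_graph 4 chain_graph"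
proof -
  have "card {e. fst e = v \<and> snd e \<in> set (nbr v)} = 4" if "v < 68" for v
  proof -
    have "{e. fst e = v \<and> snd e \<in> set (nbr v)} = Pair v ` set (nbr v)" by force
    then show ?thesis
      using that by (simp add: card_image inj_on_def distinct_card distinct_nbr length_nbr)
  qed
  then show ?thesis
    by (auto simp: regular_graph_def out_degree_def out_arcs_def chain_graph_def
        split_def conj_commute cong: conj_cong)
qed

lemma connected_chain_graph: "Digraph_Component.connected chain_graph"
proof -
  interpret graph chain_graph by (rule graph_chain_graph)
  have reach: "v \<rightarrow>\<^sup>*\<^bsub>chain_graph\<^esub> 0" if "v < 68" for v
    using that
  proof (induction v rule: less_induct)
    case (less v)
    show ?case
    proof (cases "v = 0")
      case True
      moreover have "0 \<in> verts chain_graph" by (simp add: chain_graph_def)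
      ultimately show ?thesis using reachable_refl by simp
    next
      case False
      then obtain u where u: "u \<in> set (nbr v)" "u < v" using less.prems nbr_descend by blast
      then have "v \<rightarrow>\<^bsub>chain_graph\<^esub> u"
        using less.prems by (force simp: chain_graph_def arcs_ends_def arc_to_ends_def)
      then show ?thesis
        using less u by (meson less_trans adj_reachable_trans)
    qed
  qed
  have "strongly_connected chain_graph"
  proof
    have "0 \<in> verts chain_graph" by (simp add: chain_graph_def)
    then show "verts chain_graph \<noteq> {}" by blast
    fix u v assume "u \<in> verts chain_graph" "v \<in> verts chain_graph"
    then have "u < 68" "v < 68" by (auto simp: chain_graph_def)
    then show "u \<rightarrow>\<^sup>*\<^bsub>chain_graph\<^esub> v"
      using reach symmetric_reachable[OF sym_arcs] reachable_trans by blast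
  qed
  then show ?thesis
    unfolding Digraph_Component.connected_def strongly_connected_def
    using reachable_mk_symmetric_eq[OF sym_arcs] by simp
qed

section \<open>Exact tests for segments with integer end points\<close>

definition det3 :: "int \<times> int \<Rightarrow> int \<times> int \<Rightarrow> int \<times> int \<Rightarrow> int" where
  "det3 p q r = (fst q - fst p) * (snd r - snd p) - (snd q - snd p) * (fst r - fst p)"

text \<open>\<open>det3\<close> is twice the signed area of a triangle. Without a common end point,
  the line through one segment must separate it from the other; with one, the remaining end point
  must lie off the line.\<close>

definition apart :: "int \<times> int \<Rightarrow> int \<times> int \<Rightarrow> int \<times> int \<Rightarrow> int \<times> int \<Rightarrow> bool" where
  "apart p q r s \<longleftrightarrow>
     (if p = r \<or> q = r then det3 p q s \<noteq> 0
      else if p = s \<or> q = s then det3 p q r \<noteq> 0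
      else det3 p q r > 0 \<and> det3 p q s > 0 \<or> det3 p q r < 0 \<and> det3 p q s < 0 \<or>
        det3 r s p > 0 \<and> det3 r s q > 0 \<or> det3 r s p < 0 \<and> det3 r s q < 0)"

definition grid_point :: "int \<times> int \<Rightarrow> complex" where
  "grid_point p = Complex (of_int (fst p)) (of_int (snd p))"

lemma grid_point_inject [simp]: "grid_point p = grid_point q \<longleftrightarrow> p = q"
  by (auto simp: grid_point_def prod_eq_iff)

definition side :: "complex \<Rightarrow> complex \<Rightarrow> complex \<Rightarrow> real" where
  "side a b z = (Re b - Re a) * (Im z - Im a) - (Im b - Im a) * (Re z - Re a)"

lemma side_grid_point: "side (grid_point p) (grid_point q) (grid_point r) = of_int (det3 p q r)"
  by (simp add: side_def grid_point_def det3_def)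

lemma side_convex_combination:
  "side a b ((1 - u) *\<^sub>R r + u *\<^sub>R s) = (1 - u) * side a b r + u * side a b s"
  by (simp add: side_def algebra_simps)

lemma side_on_segment:
  assumes "z \<in> closed_segment a b"
  shows "side a b z = 0"
proof -
  obtain u where "z = (1 - u) *\<^sub>R a + u *\<^sub>R b" using assms by (auto simp: closed_segment_def)
  then show ?thesis by (simp add: side_convex_combination) (simp add: side_def algebra_simps)
qed

text \<open>The affine function \<open>side\<close> vanishes on the first segment and keeps a strict
  sign on the second.\<close>

lemma segments_disjoint_if_same_side:
  assumes "det3 p q r > 0 \<and> det3 p q s > 0 \<or> det3 p q r < 0 \<and> det3 p q s < 0"
  shows "closed_segment (grid_point p) (grid_point q) \<inter>
    closed_segment (grid_point r) (grid_point s) = {}"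
proof -
  have False
    if z: "z \<in> closed_segment (grid_point p) (grid_point q)"
      "z \<in> closed_segment (grid_point r) (grid_point s)" for z
  proof -
    obtain u where u: "0 \<le> u" "u \<le> 1" "z = (1 - u) *\<^sub>R grid_point r + u *\<^sub>R grid_point s"
      using z(2) by (auto simp: closed_segment_def)
    then have eq: "(1 - u) * of_int (det3 p q r) + u * of_int (det3 p q s) = (0 :: real)"
      using side_on_segment[OF z(1)] by (simp add: side_convex_combination side_grid_point)
    from assms consider "0 < real_of_int (det3 p q r)" "0 < real_of_int (det3 p q s)"
      | "real_of_int (det3 p q r) < 0" "real_of_int (det3 p q s) < 0" by auto
    then show False
    proof cases
      case 1
      then show ?thesis
        using convex_bound_lt[of "- real_of_int (det3 p q r)" 0 "- real_of_int (det3 p q s)" "1 - u" u]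
          u eq by auto
    next
      case 2
      then show ?thesis
        using convex_bound_lt[of "real_of_int (det3 p q r)" 0 "real_of_int (det3 p q s)" "1 - u" u]
          u eq by auto
    qed
  qed
  then show ?thesis by blast
qed

text \<open>From \<open>r\<close> to \<open>s\<close> the affine function \<open>side\<close> goes
  from zero to a nonzero value, so it vanishes at \<open>r\<close> only.\<close>

lemma segments_meet_in_endpoint:
  assumes "det3 p q s \<noteq> 0" "r = p \<or> r = q"
  shows "closed_segment (grid_point p) (grid_point q) \<inter>
    closed_segment (grid_point r) (grid_point s) \<subseteq> {grid_point r}"
proof
  fix z assume z: "z \<in> closed_segment (grid_point p) (grid_point q) \<inter>
    closed_segment (grid_point r) (grid_point s)"
  then obtain u where u: "z = (1 - u) *\<^sub>R grid_point r + u *\<^sub>R grid_point s"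
    by (auto simp: closed_segment_def)
  have "det3 p q r = 0" using assms(2) by (auto simp: det3_def algebra_simps)
  then have "u = 0"
    using side_on_segment[of z "grid_point p" "grid_point q"] u z assms(1)
    by (simp add: side_convex_combination side_grid_point)
  then show "z \<in> {grid_point r}" using u by simp
qed

lemma apart_segments:
  assumes "apart p q r s"
  shows "closed_segment (grid_point p) (grid_point q) \<inter>
    closed_segment (grid_point r) (grid_point s) \<subseteq> grid_point ` ({p, q} \<inter> {r, s})"
proof -
  consider "p = r \<or> q = r" "det3 p q s \<noteq> 0" | "p = s \<or> q = s" "det3 p q r \<noteq> 0"
    | "det3 p q r > 0 \<and> det3 p q s > 0 \<or> det3 p q r < 0 \<and> det3 p q s < 0"
    | "det3 r s p > 0 \<and> det3 r s q > 0 \<or> det3 r s p < 0 \<and> det3 r s q < 0"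
    using assms unfolding apart_def by (auto split: if_splits)
  then show ?thesis
  proof cases
    case 1
    then show ?thesis using segments_meet_in_endpoint[of p q s r] by auto
  next
    case 2
    then show ?thesis
      using segments_meet_in_endpoint[of p q r s]
      unfolding closed_segment_commute[of "grid_point r" "grid_point s"] by auto
  next
    case 3
    then show ?thesis using segments_disjoint_if_same_side by simp
  next
    case 4
    then show ?thesis using segments_disjoint_if_same_side[of r s p q] by blast
  qed
qed

text \<open>The blocks on the right are moved by one unit, because \<open>apart\<close> fails for collinear edges.\<close>

definition coord :: "nat \<Rightarrow> int \<times> int" where
  "coord v =
    (let c = [(-20, 60), (-40, 20), (-40, -20), (-20, -60), (20, -60), (40, -20), (40, 20), (20, 60)];
         m = [(0, 19), (0, -19), (-100, 0), (100, 0)];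
         w = [(-62, 40), (-20, 24), (-20, -24), (-62, -40), (62, -41), (20, -25), (20, 25), (62, 41)];
         p = [(-3, 4), (3, 4), (1, 5), (-1, 5), (0, 3), (0, 9)]
     in if v < 8 then c ! v
        else if v < 12 then m ! (v - 8)
        else if v < 20 then w ! (v - 12)
        else (let (a, b) = w ! ((v - 20) div 6); (x, y) = p ! ((v - 20) mod 6)
              in (a + x, if b > 0 then b + y else b - y)))"

definition edges :: "(nat \<times> nat) list" where
  "edges = concat (map (\<lambda>u. map (Pair u) (filter (\<lambda>v. u < v) (nbr u))) [0..<68])"

lemma set_edges: "set edges = {(u, v). u < 68 \<and> v \<in> set (nbr u) \<and> u < v}"
proof -
  have "set (concat (map (\<lambda>u. map (Pair u) (filter (\<lambda>v. u < v) (nbr u))) [0..<n])) =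
    {(u, v). u < n \<and> v \<in> set (nbr u) \<and> u < v}" for n
    by auto
  then show ?thesis unfolding edges_def .
qed

text \<open>Planarity by evaluation: \<open>sorted_wrt\<close> visits each pair of edges once, and
  one order suffices because the resulting statement on segments is symmetric.\<close>

lemma edges_apart_coords:
  "sorted_wrt (\<lambda>(p, q) (r, s). apart p q r s) (map (\<lambda>(u, v). (coord u, coord v)) edges)"
  by code_simp

lemma inj_coord: "inj_on coord {..<68}"
proof -
  have "distinct (map coord [0..<68])" by code_simp
  then show ?thesis by (simp only: distinct_map set_upt atLeast0LessThan)
qed

lemma sorted_wrt_distinctD:
  "sorted_wrt R xs \<Longrightarrow> x \<in> set xs \<Longrightarrow> y \<in> set xs \<Longrightarrow> x \<noteq> y \<Longrightarrow> R x y \<or> R y x"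
  by (induction xs) auto

lemma edges_meet:
  assumes "(u, v) \<in> set edges" "(x, y) \<in> set edges" "(u, v) \<noteq> (x, y)"
  shows "closed_segment (grid_point (coord u)) (grid_point (coord v)) \<inter>
    closed_segment (grid_point (coord x)) (grid_point (coord y)) \<subseteq>
    (grid_point \<circ> coord) ` ({u, v} \<inter> {x, y})"
proof -
  have "apart (coord u) (coord v) (coord x) (coord y) \<or> apart (coord x) (coord y) (coord u) (coord v)"
    using sorted_wrt_distinctD[OF edges_apart_coords[unfolded sorted_wrt_map] assms] by simp
  then have *: "closed_segment (grid_point (coord u)) (grid_point (coord v)) \<inter>
    closed_segment (grid_point (coord x)) (grid_point (coord y)) \<subseteq>
    grid_point ` ({coord u, coord v} \<inter> {coord x, coord y})"
    using apart_segments by blast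
  have "u < 68" "v < 68" "x < 68" "y < 68"
    using assms by (auto simp: set_edges dest: nbr_less)
  then have "{coord u, coord v} \<inter> {coord x, coord y} = coord ` ({u, v} \<inter> {x, y})"
    using inj_on_image_Int[OF inj_coord, of "{u, v}" "{x, y}"] by simp
  with * show ?thesis by (simp add: image_comp)
qed

lemma planar_chain_graph: "planar_graph chain_graph"
proof -
  let ?p = "grid_point \<circ> coord"
  \<comment> \<open>The convex hull makes the segment a function of the unordered pair.\<close>
  define D where "D E = convex hull (?p ` E)" for E
  have D: "D {u, v} = closed_segment (?p u) (?p v)" for u v
    by (simp add: D_def segment_convex_hull)
  have ends: "arcs_ends chain_graph = {(u, v). u < 68 \<and> v \<in> set (nbr u)}"
    by (force simp: chain_graph_def arcs_ends_def arc_to_ends_def)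
  have verts: "verts chain_graph = {..<68}" by (simp add: chain_graph_def)
  have inj: "inj_on ?p {..<68}"
    using inj_coord by (simp add: inj_on_def)
  have oriented: "\<exists>a b. {a, b} = {u, v} \<and> (a, b) \<in> set edges" if "u < 68" "v \<in> set (nbr u)" for u v
  proof -
    have "u \<noteq> v" "v < 68" "u \<in> set (nbr v)" using that nbr_irrefl nbr_less nbr_sym by blast+
    then have "(u, v) \<in> set edges \<or> (v, u) \<in> set edges"
      using that by (auto simp: set_edges)
    then show ?thesis by (metis insert_commute)
  qed
  have meet: "D {u, v} \<inter> D {x, y} \<subseteq> ?p ` ({u, v} \<inter> {x, y})"
    if uv: "u < 68" "v \<in> set (nbr u)" and xy: "x < 68" "y \<in> set (nbr x)"
      and ne: "{u, v} \<noteq> {x, y}" for u v x y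
  proof -
    obtain a b where ab: "{a, b} = {u, v}" "(a, b) \<in> set edges" using oriented[OF uv] by blast
    obtain c d where cd: "{c, d} = {x, y}" "(c, d) \<in> set edges" using oriented[OF xy] by blast
    have "(a, b) \<noteq> (c, d)" using ab cd ne by auto
    then have "D {a, b} \<inter> D {c, d} \<subseteq> ?p ` ({a, b} \<inter> {c, d})"
      using edges_meet[OF ab(2) cd(2)] by (simp add: D)
    then show ?thesis using ab cd by simp
  qed
  have "\<exists>g. Path_Connected.arc g \<and> pathstart g = ?p u \<and> pathfinish g = ?p v \<and> path_image g = D {u, v}"
    if "u < 68" "v \<in> set (nbr u)" for u v
  proof -
    have "?p u \<noteq> ?p v" using inj nbr_irrefl[OF that] nbr_less[OF that] that(1) by (auto simp: inj_on_def)
    then show ?thesis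
      by (intro exI[of _ "linepath (?p u) (?p v)"]) (simp add: D)
  qed
  moreover have "D {u, v} \<inter> ?p ` {..<68} = {?p u, ?p v}" if uv: "u < 68" "v \<in> set (nbr u)" for u v
  proof -
    have "?p x \<in> {?p u, ?p v}" if x: "x < 68" "?p x \<in> D {u, v}" for x
    proof (cases "x \<in> {u, v}")
      case False
      \<comment> \<open>A foreign vertex on an edge is excluded by comparing that edge with any edge
        at the vertex.\<close>
      obtain y where y: "y \<in> set (nbr x)" using length_nbr[OF x(1)] by (cases "nbr x") auto
      have "{u, v} \<noteq> {x, y}" using False by auto
      moreover have "?p x \<in> D {x, y}" by (simp add: D)
      ultimately show ?thesis using meet[OF uv x(1) y] x(2) by blast
    qed auto
    moreover have "?p u \<in> D {u, v}" "?p v \<in> D {u, v}" by (simp_all add: D)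
    ultimately show ?thesis using uv(1) nbr_less[OF uv] by blast
  qed
  moreover have "D {u, v} \<inter> D {x, y} \<subseteq> ?p ` {..<68}"
    if "u < 68" "v \<in> set (nbr u)" "x < 68" "y \<in> set (nbr x)" "{u, v} \<noteq> {x, y}" for u v x y
    using meet[OF that] that(1) nbr_less[OF that(1,2)] by auto
  ultimately have "plane_drawing chain_graph ?p D"
    unfolding plane_drawing_def ends verts using inj by blast
  then show ?thesis by (auto simp: planar_graph_def)
qed

subsection \<open>Circle systems realizing the graph\<close>

lemma mid_partner_check:
  "\<forall>j \<in> set [0..<8]. partner j < 8 \<and> partner j \<noteq> j \<and> partner (partner j) = j \<and>
     (j, partner j) \<in> set [(1, 6), (2, 5), (0, 3), (4, 7), (6, 1), (5, 2), (3, 0), (7, 4)] \<and>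
     mid (partner j) = mid j \<and> 8 \<le> mid j \<and> mid j < 12 \<and>
     (nbr (mid j) = [j, 12 + j, partner j, 12 + partner j] \<or>
      nbr (mid j) = [partner j, 12 + partner j, j, 12 + j]) \<and>
     (\<forall>i \<in> set [0..<8]. mid i = mid j \<longrightarrow> i = j \<or> i = partner j)"
  by code_simp

lemma partner_mid:
  assumes "j < 8"
  shows "partner j < 8" "partner j \<noteq> j" "partner (partner j) = j" "mid (partner j) = mid j"
    "8 \<le> mid j" "mid j < 12" "set (nbr (mid j)) = {j, 12 + j, partner j, 12 + partner j}"
    "i < 8 \<Longrightarrow> mid i = mid j \<Longrightarrow> i = j \<or> i = partner j"
    "(j, partner j) \<in> {(1, 6), (2, 5), (0, 3), (4, 7), (6, 1), (5, 2), (3, 0), (7, 4)}"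
  using mid_partner_check[unfolded set_upt list.set, rule_format, of j] assms by auto

lemma nbr_cycle: "j < 8 \<Longrightarrow> set (nbr j) = {(j + 1) mod 8, (j + 7) mod 8, mid j, 12 + j}"
  by (simp add: nbr_def)

lemma nbr_subdivision: "j < 8 \<Longrightarrow> set (nbr (12 + j)) = {j, mid j, 20 + 6 * j, 21 + 6 * j}"
  by (simp add: nbr_def)

lemma nbr_block:
  assumes "j < 8"
  shows "set (nbr (20 + 6 * j)) = {12 + j, 23 + 6 * j, 24 + 6 * j, 25 + 6 * j}"
    "set (nbr (21 + 6 * j)) = {12 + j, 22 + 6 * j, 24 + 6 * j, 25 + 6 * j}"
    "set (nbr (22 + 6 * j)) = {21 + 6 * j, 23 + 6 * j, 24 + 6 * j, 25 + 6 * j}"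
    "set (nbr (23 + 6 * j)) = {20 + 6 * j, 22 + 6 * j, 24 + 6 * j, 25 + 6 * j}"
    "set (nbr (24 + 6 * j)) = {20 + 6 * j, 21 + 6 * j, 22 + 6 * j, 23 + 6 * j}"
    "set (nbr (25 + 6 * j)) = {20 + 6 * j, 21 + 6 * j, 22 + 6 * j, 23 + 6 * j}"
proof -
  have "(20 + 6 * j + k - 20) div 6 = j" "(20 + 6 * j + k - 20) mod 6 = k" if "k < 6" for k
    using that by auto
  then have *: "nbr (20 + 6 * j + k) =
    (if k < 2 then [12 + j] else []) @ map (\<lambda>i. 20 + 6 * j + i) (block_nbr k)" if "k < 6" for k
    using that by (simp only: nbr_def Let_def) simp
  show "set (nbr (20 + 6 * j)) = {12 + j, 23 + 6 * j, 24 + 6 * j, 25 + 6 * j}"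
    "set (nbr (21 + 6 * j)) = {12 + j, 22 + 6 * j, 24 + 6 * j, 25 + 6 * j}"
    "set (nbr (22 + 6 * j)) = {21 + 6 * j, 23 + 6 * j, 24 + 6 * j, 25 + 6 * j}"
    "set (nbr (23 + 6 * j)) = {20 + 6 * j, 22 + 6 * j, 24 + 6 * j, 25 + 6 * j}"
    "set (nbr (24 + 6 * j)) = {20 + 6 * j, 21 + 6 * j, 22 + 6 * j, 23 + 6 * j}"
    "set (nbr (25 + 6 * j)) = {20 + 6 * j, 21 + 6 * j, 22 + 6 * j, 23 + 6 * j}"
    using *[of 0] *[of 1] *[of 2] *[of 3] *[of 4] *[of 5] by (simp_all add: block_nbr_def)
qed

locale realized_chain_graph =
  realized_graph \<C> "{..<68 :: nat}" "\<lambda>v. set (nbr v)" \<phi> \<gamma> for \<C> \<phi> \<gamma>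
begin

definition K :: "nat \<Rightarrow> complex set" where
  "K j = col j (mid j)"

text \<open>The two edges from \<open>12 + j\<close> into its block share a colour by
  \<open>pendant_block_col\<close>, hence so do the other two.\<close>

lemma col_subdivision:
  assumes j: "j < 8"
  shows "col (12 + j) j = col (12 + j) (mid j)"
proof -
  note nb = nbr_block[OF j] and sub = nbr_subdivision[OF j]
  have "col (20 + 6 * j) (12 + j) = col (21 + 6 * j) (12 + j)"
    using j by (intro pendant_block_col[OF _ _ nb]) auto
  moreover have "col (20 + 6 * j) (12 + j) = col (12 + j) (20 + 6 * j)"
    "col (21 + 6 * j) (12 + j) = col (12 + j) (21 + 6 * j)"
    using j sub by (intro col_commute; simp)+
  ultimately have "col (12 + j) (20 + 6 * j) = col (12 + j) (21 + 6 * j)" by simp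
  then show ?thesis
    using col_pair(1)[of "12 + j", OF _ sub] j partner_mid(5,6)[OF j] by simp
qed

lemma col_digon:
  assumes j: "j < 8"
  shows "col j (mid j) = col j (12 + j)"
proof (rule chain_col[where v = "partner j" and w' = "12 + partner j"])
  note pm = partner_mid[OF j]
  show "{j, mid j, partner j, 12 + j, 12 + partner j} \<subseteq> {..<68}" using j pm by auto
  show "distinct [j, mid j, partner j]" "distinct [j, 12 + j, partner j, 12 + partner j]"
    using j pm by auto
  show "mid j \<in> set (nbr j)" "12 + j \<in> set (nbr j)" using nbr_cycle[OF j] by auto
  show "set (nbr (mid j)) = {j, 12 + j, partner j, 12 + partner j}" by (rule pm(7))
  show "{j, mid j} \<subseteq> set (nbr (12 + j))" using nbr_subdivision[OF j] by auto
  show "{partner j, mid j} \<subseteq> set (nbr (12 + partner j))" using nbr_subdivision[OF pm(1)] pm(4) by auto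
  show "col (12 + j) j = col (12 + j) (mid j)" by (rule col_subdivision[OF j])
  show "col (12 + partner j) (partner j) = col (12 + partner j) (mid j)"
    using col_subdivision[OF pm(1)] pm(4) by simp
qed

lemma cycle_distinct:
  assumes j: "j < 8"
  shows "distinct [(j + 1) mod 8, (j + 7) mod 8, mid j, 12 + j]"
proof -
  have "mid j < 12" "8 \<le> mid j" using partner_mid[OF j] by auto
  moreover have "(j + 1) mod 8 < 8" "(j + 7) mod 8 < 8" "(j + 1) mod 8 \<noteq> (j + 7) mod 8" by (simp, simp, presburger)
  ultimately show ?thesis by auto
qed

lemma K_vertices:
  assumes j: "j < 8"
  shows "{t \<in> {..<68}. \<phi> t \<in> K j} = {j, mid j, 12 + j}"
  unfolding K_def
proof (rule digon_circle_vertices[OF _ nbr_cycle[OF j] partner_mid(7)[OF j] nbr_subdivision[OF j]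
      cycle_distinct[OF j]])
  note pm = partner_mid[OF j]
  show "{j, mid j, 12 + j} \<subseteq> {..<68}" "distinct [j, 12 + j, partner j, 12 + partner j]"
    "distinct [j, mid j, 20 + 6 * j, 21 + 6 * j]"
    using j pm by auto
qed (use col_digon[OF j] col_subdivision[OF j] in auto)

text \<open>At every cycle vertex the digon takes one circle, so the two cycle edges share the
  other; induction carries this around.\<close>

lemma col_cycle:
  assumes j: "j < 8"
  shows "col j ((j + 1) mod 8) = col 0 1"
  using j
proof (induction j)
  case (Suc j)
  have j: "Suc j < 8" "j < 8" using Suc.prems by auto
  have V: "Suc j \<in> {..<68}" "j \<in> {..<68}" using j by auto
  have mod: "(j + 1) mod 8 = Suc j" "(Suc j + 7) mod 8 = j" using j by auto
  have "col (Suc j) ((Suc j + 1) mod 8) = col (Suc j) ((Suc j + 7) mod 8)"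
    by (rule col_pair(1)[OF V(1) nbr_cycle[OF j(1)] cycle_distinct[OF j(1)] col_digon[OF j(1)]])
  also have "\<dots> = col j (Suc j)"
    unfolding mod using col_commute[OF V(2), of "Suc j"] nbr_cycle[OF j(2)] mod(1) by simp
  finally show ?case using Suc.IH j(2) mod(1) by simp
qed simp

text \<open>The edges leaving the cycle carry the colour of a digon, so the circle of the cycle
  never follows them.\<close>

lemma cycle_vertices: "{t \<in> {..<68}. \<phi> t \<in> col 0 1} = {..<8}"
proof
  have V: "0 \<in> {..<68 :: nat}" by simp
  have nb0: "1 \<in> set (nbr 0)" using nbr_cycle[of 0] by simp
  show "{t \<in> {..<68}. \<phi> t \<in> col 0 1} \<subseteq> {..<8}"
  proof (rule circle_vertices_subset)
    show "col 0 1 \<in> \<C>" "\<phi> 0 \<in> col 0 1" using col_circle[OF V nb0] by auto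
    fix u n assume u: "u \<in> {..<8 :: nat}" "n \<in> set (nbr u)" "col u n = col 0 1"
    then have u8: "u < 8" and V: "u \<in> {..<68}" by auto
    have "col u ((u + 1) mod 8) \<noteq> col u (mid u)"
      by (rule col_pair(2)[OF V nbr_cycle[OF u8] cycle_distinct[OF u8] col_digon[OF u8]])
    then have "n \<noteq> mid u" "n \<noteq> 12 + u" using u(3) col_cycle[OF u8] col_digon[OF u8] by auto
    then show "n \<in> {..<8}" using u(2) nbr_cycle[OF u8] by auto
  qed auto
  show "{..<8} \<subseteq> {t \<in> {..<68}. \<phi> t \<in> col 0 1}"
  proof
    fix j :: nat assume "j \<in> {..<8}"
    then have j: "j < 8" "j \<in> {..<68}" by auto
    have "\<phi> j \<in> col j ((j + 1) mod 8)" using col_circle(2)[OF j(2)] nbr_cycle[OF j(1)] by simp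
    then show "j \<in> {t \<in> {..<68}. \<phi> t \<in> col 0 1}" using col_cycle[OF j(1)] j by simp
  qed
qed

text \<open>Common points of distinct circles are meeting points, that is, vertices; intersections
  thus become intersections of vertex sets.\<close>

lemma common_points:
  assumes "A \<in> \<C>" "B \<in> \<C>" "A \<noteq> B"
  shows "A \<inter> B = \<phi> ` ({t \<in> {..<68}. \<phi> t \<in> A} \<inter> {t \<in> {..<68}. \<phi> t \<in> B})"
proof -
  have "A \<inter> B \<subseteq> meeting_points \<C>" using assms by (auto simp: meeting_points_def)
  then show ?thesis using verts by auto
qed

lemma realized_chain_graph_False: False
proof -
  have K: "K j \<in> \<C>" if "j < 8" for j
    using col_circle(1)[of j "mid j"] nbr_cycle[OF that] that by (simp add: K_def)
  have C: "col 0 1 \<in> \<C>" using col_circle(1)[of 0 1] nbr_cycle[of 0] by simp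
  obtain c R where cR: "0 < R" "col 0 1 = sphere c R" using circleE[OF C] .
  show False
  proof (rule no_circle_chain_configuration[OF cR(1), of \<phi> c K])
    show "\<phi> i \<in> sphere c R" if "i < 8" for i
      using cycle_vertices that cR(2) by blast
    show "inj_on \<phi> {..<8}" using inj by (rule inj_on_subset) auto
    show "\<exists>k r. 0 < r \<and> K i = sphere k r" if "i < 8" for i using circleE[OF K[OF that]] by metis
    show "sphere c R \<inter> K i = {\<phi> i}" if i: "i < 8" for i
    proof -
      \<comment> \<open>The subdividing vertex shows that the circles differ, as
        \<open>common_points\<close> requires.\<close>
      have "12 + i \<in> {t \<in> {..<68}. \<phi> t \<in> K i}" "12 + i \<notin> {t \<in> {..<68}. \<phi> t \<in> col 0 1}"
        unfolding K_vertices[OF i] cycle_vertices by auto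
      then have "col 0 1 \<noteq> K i" by auto
      then have "sphere c R \<inter> K i = \<phi> ` ({..<8} \<inter> {i, mid i, 12 + i})"
        using common_points[OF C K[OF i]] K_vertices[OF i] cycle_vertices cR(2) by simp
      also have "{..<8} \<inter> {i, mid i, 12 + i} = {i}" using i partner_mid(5)[OF i] by auto
      finally show ?thesis by simp
    qed
    have meet: "K i \<inter> K j = \<phi> ` ({i, mid i, 12 + i} \<inter> {j, mid j, 12 + j})"
      if i: "i < 8" "j < 8" "i \<noteq> j" for i j
    proof -
      have "12 + i \<in> {t \<in> {..<68}. \<phi> t \<in> K i}" "12 + i \<notin> {t \<in> {..<68}. \<phi> t \<in> K j}"
        unfolding K_vertices[OF i(1)] K_vertices[OF i(2)] using i partner_mid(6)[OF i(2)] by auto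
      then have "K i \<noteq> K j" by auto
      then show ?thesis
        using common_points[OF K[OF i(1)] K[OF i(2)]] K_vertices[OF i(1)] K_vertices[OF i(2)] by simp
    qed
    show "\<exists>m. K i \<inter> K j = {m}" if ij: "(i, j) \<in> {(1, 6), (2, 5), (0, 3), (4, 7)}" for i j
    proof -
      have i: "i < 8" "j < 8" "i \<noteq> j" and "mid i = mid j" using ij by (auto simp: mid_def)
      then have "{i, mid i, 12 + i} \<inter> {j, mid j, 12 + j} = {mid i}"
        using partner_mid(5,6)[of i] by auto
      then show ?thesis using meet[OF i] by auto
    qed
    show "K i \<inter> K j = {}" if i: "i < 8" "j < 8" "i \<noteq> j" and
      ij: "(i, j) \<notin> {(1, 6), (2, 5), (0, 3), (4, 7), (6, 1), (5, 2), (3, 0), (7, 4)}" for i j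
    proof -
      \<comment> \<open>The excluded pairs contain every \<open>(partner j, j)\<close>, so
        \<open>i\<close> and \<open>j\<close> lie on different chains and have different middle
        vertices.\<close>
      have "(partner j, j) \<in> {(1, 6), (2, 5), (0, 3), (4, 7), (6, 1), (5, 2), (3, 0), (7, 4)}"
        using partner_mid(9)[OF partner_mid(1)[OF i(2)]] by (simp only: partner_mid(3)[OF i(2)])
      then have "i \<noteq> partner j" using ij by metis
      then have "mid i \<noteq> mid j" using partner_mid(8)[OF i(2,1)] i(3) by blast
      then have "{i, mid i, 12 + i} \<inter> {j, mid j, 12 + j} = {}"
        using i partner_mid(5,6)[OF i(1)] partner_mid(5,6)[OF i(2)] by auto
      then show ?thesis using meet[OF i] by simp
    qed
    show "\<exists>g. path g \<and> pathstart g = \<phi> j \<and> pathfinish g = \<phi> (Suc j) \<and> path_image g \<subseteq> sphere c R \<and>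
      (\<forall>t. 0 < t \<and> t < 1 \<longrightarrow> g t \<notin> \<phi> ` {..<8})" if j: "j < 6" for j
    proof (intro exI conjI)
      have V: "j \<in> {..<68}" and n: "Suc j \<in> set (nbr j)" using j nbr_cycle[of j] by auto
      note arc = arc_mem[OF V n]
      show "pathstart (\<gamma> j (Suc j)) = \<phi> j" "pathfinish (\<gamma> j (Suc j)) = \<phi> (Suc j)"
        using start[OF V n] finish[OF V n] .
      have "col j (Suc j) = sphere c R" using col_cycle[of j] cR(2) j by simp
      then show "path_image (\<gamma> j (Suc j)) \<subseteq> sphere c R" using circle_of(2)[OF arc] by (simp add: col_def)
      have "g t \<notin> meeting_points \<C>" if "g = \<gamma> j (Suc j)" "0 < t" "t < 1" for g t
        by (rule arcE[OF arc]) (use that in auto)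
      moreover have "\<phi> ` {..<8} \<subseteq> meeting_points \<C>" unfolding verts[symmetric] by (intro image_mono) auto
      ultimately show "\<forall>t. 0 < t \<and> t < 1 \<longrightarrow> \<gamma> j (Suc j) t \<notin> \<phi> ` {..<8}" by blast
      show "path (\<gamma> j (Suc j))" by (rule arcE[OF arc]) simp
    qed
  qed
qed

end

lemma chain_graph_not_realizable: "\<not> realizable_by_circles chain_graph"
proof
  assume "realizable_by_circles chain_graph"
  then obtain \<C> f where sys: "circle_system \<C>" and iso: "pre_digraph.digraph_isomorphism chain_graph f"
    and eq: "circle_system_graph \<C> = app_iso f chain_graph"
    by (auto simp: realizable_by_circles_def digraph_iso_def)
  define \<phi> where "\<phi> = iso_verts f"
  define \<gamma> where "\<gamma> u v = iso_arcs f (u, v)" for u v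
  have verts: "meeting_points \<C> = \<phi> ` {..<68}"
    using arg_cong[OF eq, of verts] by (simp add: circle_system_graph_def app_iso_def \<phi>_def chain_graph_def)
  have arcs: "consecutive_arcs \<C> = {\<gamma> u v | u v. u \<in> {..<68} \<and> v \<in> set (nbr u)}"
    using arg_cong[OF eq, of arcs] by (auto simp: circle_system_graph_def app_iso_def \<gamma>_def chain_graph_def)
  have tail: "pathstart = iso_tail f" and head: "pathfinish = iso_head f"
    using arg_cong[OF eq, of tail] arg_cong[OF eq, of head] by (simp_all add: circle_system_graph_def app_iso_def)
  have inj: "inj_on \<phi> {..<68}"
    using iso by (simp add: pre_digraph.digraph_isomorphism_def \<phi>_def chain_graph_def)
  have "pathstart (\<gamma> u v) = \<phi> u \<and> pathfinish (\<gamma> u v) = \<phi> v" if "u < 68" "v \<in> set (nbr u)" for u v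
    using iso that by (simp add: pre_digraph.digraph_isomorphism_def tail head \<phi>_def \<gamma>_def chain_graph_def)
  then interpret realized_chain_graph \<C> \<phi> \<gamma>
    using sys verts arcs inj nbr_less by unfold_locales auto
  show False by (rule realized_chain_graph_False)
qed

theorem theorem3:
  shows "\<exists>G :: (nat, nat \<times> nat) pre_digraph.
           graph G \<and> Digraph_Component.connected G \<and> regular_graph 4 G \<and> planar_graph G \<and>
           \<not> realizable_by_circles G"
  using graph_chain_graph connected_chain_graph regular_chain_graph planar_chain_graph
    chain_graph_not_realizable by blast

end
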